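(* For every integer $\mathfrak{M}\geq 1$, the escalator tree $T_{\mathfrak{M}}$ is finite.
   Context: For $m\geq3$, $P_m(x)=\frac{(m-2)x^2-(m-4)x}{2}$ ($x\in\mathbb{Z}$). A sum of generalized polygonal numbers is $F=a_1P_{m_1}+\cdots+a_rP_{m_r}$ (as a function of $(x_1,\dots,x_r)\in\mathbb{Z}^r$) with integers $1\le a_1\le\dots\le a_r$, $m_i\ge 3$; it represents $n$ if $n=F(x)$ for some $x$, and is universal if it represents all positive integers. The truant $t(F)$ is the smallest positive integer not represented by $F$ ($t(F)=\infty$ if $F$ is universal). $\mathcal{C}_{\mathfrak{M}}$ is the class of sums with $\operatorname{lcm}(m_1-2,\dots,m_r-2)\le\mathfrak{M}$. The escalator tree $T_{\mathfrak{M}}$ is the rooted tree defined inductively: the root is the empty sum $F=0$ (depth $0$, truant $1$); a universal node is a leaf; if a node $F=\sum_{j=1}^r a_jP_{m_j}$ of depth $r$ has $t(F)<\infty$, its children (of depth $r+1$) are all sums $F+a_{r+1}P_{m_{r+1}}\in\mathcal{C}_{\mathfrak{M}}$ with $a_r\le a_{r+1}\le t(F)$, $m_{r+1}\ge3$, $m_{r+1}\ne 6$, and $m_r\le m_{r+1}$ whenever $a_r=a_{r+1}$ (for the root, the children are the sums $P_{m_1}\in\mathcal{C}_{\mathfrak{M}}$ with $m_1\neq 6$). *)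

theory Defs
  imports Main "HOL-Library.Extended_Nat"
begin

definition polygonal :: "nat \<Rightarrow> int \<Rightarrow> int" where
  "polygonal m x = ((int m - 2) * x\<^sup>2 - (int m - 4) * x) div 2"

text \<open>The integer division is exact.\<close>

lemma two_times_polygonal:
  "2 * polygonal m x = (int m - 2) * x\<^sup>2 - (int m - 4) * x"
proof -
  have "(int m - 2) * x\<^sup>2 - (int m - 4) * x = (int m - 2) * (x * (x - 1)) + 2 * x"
    by (simp add: algebra_simps power2_eq_square)
  moreover have "even (x * (x - 1))"
    by simp
  ultimately have "even ((int m - 2) * x\<^sup>2 - (int m - 4) * x)"
    by simp
  then show ?thesis
    by (simp add: polygonal_def)
qed

text \<open>The sum \<open>a\<^sub>1 P\<^bsub>m\<^sub>1\<^esub> + \<dots> + a\<^sub>r P\<^bsub>m\<^sub>r\<^esub>\<close> is the list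
  \<open>[(a\<^sub>1, m\<^sub>1), \<dots>, (a\<^sub>r, m\<^sub>r)]\<close>; the empty list is the sum \<open>0\<close>.\<close>

type_synonym polysum = "(nat \<times> nat) list"

definition is_polysum :: "polysum \<Rightarrow> bool" where
  "is_polysum F \<longleftrightarrow> (\<forall>(a, m) \<in> set F. 1 \<le> a \<and> 3 \<le> m) \<and> sorted (map fst F)"

definition polysum_value :: "polysum \<Rightarrow> int list \<Rightarrow> int" where
  "polysum_value F x = (\<Sum>i<length F. int (fst (F ! i)) * polygonal (snd (F ! i)) (x ! i))"

definition represents :: "polysum \<Rightarrow> nat \<Rightarrow> bool" where
  "represents F n \<longleftrightarrow> (\<exists>x. length x = length F \<and> polysum_value F x = int n)"

definition universal :: "polysum \<Rightarrow> bool" where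
  "universal F \<longleftrightarrow> (\<forall>n\<ge>1. represents F n)"

definition truant :: "polysum \<Rightarrow> enat" where
  "truant F = (if universal F then \<infinity> else enat (LEAST n. 1 \<le> n \<and> \<not> represents F n))"

text \<open>The empty sum belongs to the class for every \<open>M \<ge> 1\<close>, since \<open>Lcm {} = 1\<close>.\<close>

definition polysum_class :: "nat \<Rightarrow> polysum set" where
  "polysum_class M = {F. is_polysum F \<and> Lcm ((\<lambda>(a, m). m - 2) ` set F) \<le> M}"

text \<open>Edges of the escalator tree. For the root \<open>F = []\<close>, whose truant is \<open>1\<close>, the conditions
  force the new coefficient to be \<open>1\<close>.\<close>

definition escalator_child :: "nat \<Rightarrow> polysum \<Rightarrow> polysum \<Rightarrow> bool" where
  "escalator_child M F G \<longleftrightarrow> truant F < \<infinity> \<and>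
     (\<exists>a m. G = F @ [(a, m)] \<and> G \<in> polysum_class M \<and>
        enat a \<le> truant F \<and> 3 \<le> m \<and> m \<noteq> 6 \<and>
        (F \<noteq> [] \<longrightarrow> fst (last F) \<le> a \<and> (fst (last F) = a \<longrightarrow> snd (last F) \<le> m)))"

lemma truant_root: "truant [] = 1"
proof -
  have rep: "represents [] n \<longleftrightarrow> n = 0" for n
    by (auto simp: represents_def polysum_value_def)
  then have "\<not> universal []"
    by (auto simp: universal_def)
  moreover have "(LEAST n. 1 \<le> n \<and> \<not> represents [] n) = 1"
    by (rule Least_equality) (auto simp: rep)
  ultimately show ?thesis
    by (simp add: truant_def one_enat_def)
qed

text \<open>The vertex set of the escalator tree. A node is a list, so it determines the path leading to
  it from the root (its prefixes), and distinct vertices of the tree are distinct lists.\<close>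

inductive_set escalator_tree :: "nat \<Rightarrow> polysum set" for M :: nat where
  root: "[] \<in> escalator_tree M"
| child: "F \<in> escalator_tree M \<Longrightarrow> escalator_child M F G \<Longrightarrow> G \<in> escalator_tree M"

end

(* Otherwise Koenig's lemma gives an infinite branch, that is, an infinite sequence of terms
   a_i P_{m_i} with m_i bounded all of whose prefixes have finite truant, while every n is represented
   by some prefix. Let S(J) be the set of integers represented by a finite index set J of the branch.

   Local part: if enough of the m_i in J agree, then modulo every D the set S(J) is closed under adding
   a fixed E depending only on J. (For each prime p four of the coefficients agree up to squares in Q_p,
   so that Lagrange's four-square theorem applies, unless one can already change a single variable by
   Hensel lifting.) Hence some prefix R represents every residue class modulo every D.

   Global part: three indices give a set of positive lower density, by a second moment bound for
   the number of representations. Since P_m(x) + P_m(-x) = (m-2) x^2, every multiple of d = a(m-2) is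
   a sum of 8 values of a P_m. So if adjoining the term a P_m to J adds only few integers below N, then
   S(J) is almost invariant under translation by multiples of d, and S(J) contains almost all elements
   of a progression u, u+d, u+2d, ... below N, with u < N/3. Adjoining T terms one after the other,
   for each N one of these steps adds at most N/T integers. For T large, such an almost full
   progression, three further indices and the prefix R together represent n = N - 1; hence some
   prefix represents all large integers, and a longer one is universal, a contradiction. *)

theory Submission
  imports Defs "HOL-Number_Theory.Number_Theory"
begin

text \<open>The lcm bound limits only the m_i; the coefficients along a branch have no bound a
  priori, so no fixed finite list of quadratic forms covers them. Hence the argument relies on
  counting, with constants taken from terms chosen in a fixed order: first the prefix R, then two
  disjoint triples whose value sets have lower densities delta0 and delta1, then T with T * delta0 *
  delta1 > 256, and after that the T further terms. The step that adds few integers varies with N,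
  but its T candidates do not, so one bound on n serves for all. Three indices are used for density
  because sums of two squares already have density zero; with three, the collision count meets the
  convergent sum of 1/g^2 instead of a logarithm. At the end, b runs through values of one triple in
  a single residue class modulo d, and one f in R brings n - f - b into the class of u for all these
  b. Different b hit different places of the progression, and the progression has fewer gaps than
  there are b.\<close>

section \<open>Lagrange's four-square theorem\<close>

definition four_squares :: "int \<Rightarrow> bool" where
  "four_squares n \<longleftrightarrow> (\<exists>a b c d. n = a\<^sup>2 + b\<^sup>2 + c\<^sup>2 + d\<^sup>2)"

text \<open>Euler's identity: the quaternion norm is multiplicative, applied to one factor and the
  conjugate of the other.\<close>

lemma four_squares_mult:
  assumes "four_squares m" "four_squares n" shows "four_squares (m * n)"
proof -
  obtain a b c d where m: "m = a\<^sup>2 + b\<^sup>2 + c\<^sup>2 + d\<^sup>2" using assms(1) by (auto simp: four_squares_def)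
  obtain e f g h where n: "n = e\<^sup>2 + f\<^sup>2 + g\<^sup>2 + h\<^sup>2" using assms(2) by (auto simp: four_squares_def)
  have "m * n = (a*e+b*f+c*g+d*h)\<^sup>2 + (a*f-b*e+c*h-d*g)\<^sup>2 + (a*g-c*e+d*f-b*h)\<^sup>2 + (a*h-d*e+b*g-c*f)\<^sup>2"
    unfolding m n by (simp add: power2_eq_square algebra_simps)
  then show ?thesis unfolding four_squares_def by blast
qed

lemma centered_remainder:
  fixes m x :: int assumes "m > 0"
  obtains t y where "x = y + m * t" "4 * y\<^sup>2 \<le> m\<^sup>2"
proof -
  define y where "y = (x + m div 2) mod m - m div 2"
  have "0 \<le> (x + m div 2) mod m" "(x + m div 2) mod m < m" using assms by auto
  then have "-m \<le> 2 * y" "2 * y \<le> m" unfolding y_def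
    using div_mult_mod_eq[of m 2] pos_mod_bound[of 2 m] pos_mod_sign[of 2 m] by simp_all
  then have "\<bar>2 * y\<bar> \<le> \<bar>m\<bar>" by linarith
  then have "(2 * y)\<^sup>2 \<le> m\<^sup>2" by (simp only: abs_le_square_iff)
  moreover have "x = y + m * ((x + m div 2) div m)"
    unfolding y_def by (smt (verit) mult_div_mod_eq)
  ultimately show ?thesis using that[of y] by (simp add: power_mult_distrib)
qed

text \<open>Descent on the multiplier m: the centered remainders y_i of the four roots modulo m have
  square sum m * r with r <= m, and Euler's identity turns the representation of m * p into one of r
  * p.\<close>

lemma four_squares_descent:
  fixes p :: int
  assumes p: "prime p"
  shows "0 < m \<Longrightarrow> m < p \<Longrightarrow> four_squares (m * p) \<Longrightarrow> four_squares p"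
proof (induction "nat m" arbitrary: m rule: less_induct)
  case less
  show ?case
  proof (cases "m = 1")
    case True then show ?thesis using less by simp
  next
    case False
    then have m: "1 < m" "m < p" using less by auto
    obtain x1 x2 x3 x4 where x: "m * p = x1\<^sup>2 + x2\<^sup>2 + x3\<^sup>2 + x4\<^sup>2"
      using less.prems by (auto simp: four_squares_def)
    obtain t1 y1 where 1: "x1 = y1 + m * t1" "4 * y1\<^sup>2 \<le> m\<^sup>2" using centered_remainder m by (metis less.prems(1))
    obtain t2 y2 where 2: "x2 = y2 + m * t2" "4 * y2\<^sup>2 \<le> m\<^sup>2" using centered_remainder m by (metis less.prems(1))
    obtain t3 y3 where 3: "x3 = y3 + m * t3" "4 * y3\<^sup>2 \<le> m\<^sup>2" using centered_remainder m by (metis less.prems(1))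
    obtain t4 y4 where 4: "x4 = y4 + m * t4" "4 * y4\<^sup>2 \<le> m\<^sup>2" using centered_remainder m by (metis less.prems(1))
    define r where "r = p - 2*(y1*t1+y2*t2+y3*t3+y4*t4) - m*(t1\<^sup>2+t2\<^sup>2+t3\<^sup>2+t4\<^sup>2)"
    have r: "y1\<^sup>2 + y2\<^sup>2 + y3\<^sup>2 + y4\<^sup>2 = m * r"
      using x unfolding 1(1) 2(1) 3(1) 4(1) r_def by (simp add: algebra_simps power2_eq_square)
    have "0 \<le> m * r" unfolding r[symmetric] by simp
    then have r0: "0 \<le> r" using m by (simp add: zero_le_mult_iff)
    have "m * r \<le> m * m" using r 1(2) 2(2) 3(2) 4(2) by (simp add: power2_eq_square)
    then have rm: "r \<le> m" using m by simp
    \<comment> \<open>Both extreme values r = 0 and r = m would make m divide every 2 * y_i and r,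
      hence also p, although 1 < m < p.\<close>
    have no: "\<not> (m dvd 2*y1 \<and> m dvd 2*y2 \<and> m dvd 2*y3 \<and> m dvd 2*y4 \<and> m dvd r)"
    proof
      assume A: "m dvd 2*y1 \<and> m dvd 2*y2 \<and> m dvd 2*y3 \<and> m dvd 2*y4 \<and> m dvd r"
      have "p = 2*y1*t1+2*y2*t2+2*y3*t3+2*y4*t4 + m*(t1\<^sup>2+t2\<^sup>2+t3\<^sup>2+t4\<^sup>2) + r"
        unfolding r_def by (simp add: algebra_simps)
      then have "m dvd p" using A by (metis dvd_add dvd_mult2 dvd_triv_left)
      then show False using p m by (metis less_le_not_le not_less prime_int_iff zdvd_imp_le less.prems(1) linorder_not_le)
    qed
    have "r \<noteq> 0"
    proof
      assume "r = 0"
      then have "y1\<^sup>2 + y2\<^sup>2 + y3\<^sup>2 + y4\<^sup>2 = 0" using r by simp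
      then have "y1 = 0 \<and> y2 = 0 \<and> y3 = 0 \<and> y4 = 0"
        by (smt (verit) zero_le_power2 zero_eq_power2)
      then show False using no \<open>r = 0\<close> by simp
    qed
    moreover have "r \<noteq> m"
    proof
      assume "r = m"
      then have "y1\<^sup>2 + y2\<^sup>2 + y3\<^sup>2 + y4\<^sup>2 = m\<^sup>2" using r by (simp add: power2_eq_square)
      then have "(2*y1)\<^sup>2 = m\<^sup>2" "(2*y2)\<^sup>2 = m\<^sup>2" "(2*y3)\<^sup>2 = m\<^sup>2" "(2*y4)\<^sup>2 = m\<^sup>2"
        using 1 2 3 4 by (simp_all add: power_mult_distrib)
      then have "m dvd 2*y1 \<and> m dvd 2*y2 \<and> m dvd 2*y3 \<and> m dvd 2*y4"
        by (metis dvd_refl pow_divides_pow_iff zero_less_numeral)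
      then show False using no \<open>r = m\<close> by simp
    qed
    ultimately have rr: "0 < r" "r < m" using r0 rm by auto
    \<comment> \<open>The quotients by m of the four expressions in Euler's identity for the tuples
      x and y. The first expression is divisible by m because the y_i^2 sum to m * r.\<close>
    define z1 where "z1 = r + t1*y1 + t2*y2 + t3*y3 + t4*y4"
    define z2 where "z2 = t1*y2-t2*y1+t3*y4-t4*y3"
    define z3 where "z3 = t1*y3-t3*y1+t4*y2-t2*y4"
    define z4 where "z4 = t1*y4-t4*y1+t2*y3-t3*y2"
    have "(m * p) * (m * r) = (x1*y1+x2*y2+x3*y3+x4*y4)\<^sup>2 + (x1*y2-x2*y1+x3*y4-x4*y3)\<^sup>2
       + (x1*y3-x3*y1+x4*y2-x2*y4)\<^sup>2 + (x1*y4-x4*y1+x2*y3-x3*y2)\<^sup>2"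
      unfolding x r[symmetric] by (simp add: power2_eq_square algebra_simps)
    moreover have "x1*y1+x2*y2+x3*y3+x4*y4 = m * z1"
      using r unfolding 1(1) 2(1) 3(1) 4(1) z1_def by (simp add: algebra_simps power2_eq_square)
    moreover have "x1*y2-x2*y1+x3*y4-x4*y3 = m * z2" "x1*y3-x3*y1+x4*y2-x2*y4 = m * z3"
      "x1*y4-x4*y1+x2*y3-x3*y2 = m * z4"
      unfolding 1(1) 2(1) 3(1) 4(1) z2_def z3_def z4_def by (simp_all add: algebra_simps)
    ultimately have "(m * p) * (m * r) = m\<^sup>2 * (z1\<^sup>2+z2\<^sup>2+z3\<^sup>2+z4\<^sup>2)"
      by (simp add: power_mult_distrib algebra_simps)
    then have "m\<^sup>2 * (r * p) = m\<^sup>2 * (z1\<^sup>2+z2\<^sup>2+z3\<^sup>2+z4\<^sup>2)"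
      by (simp add: power2_eq_square algebra_simps)
    then have "r * p = z1\<^sup>2+z2\<^sup>2+z3\<^sup>2+z4\<^sup>2" using m by simp
    then have "four_squares (r * p)" unfolding four_squares_def by blast
    then show ?thesis using less.hyps[of r] rr m by auto
  qed
qed

text \<open>The (p + 1) / 2 residues x^2 and the (p + 1) / 2 residues - 1 - y^2 cannot be disjoint
  modulo p. The bounds on x and y make the quotient by p smaller than p, as the descent
  requires.\<close>

lemma prime_dvd_two_squares_plus_one:
  fixes p :: int
  assumes p: "prime p" "p \<noteq> 2"
  obtains x y where "p dvd x\<^sup>2 + y\<^sup>2 + 1" "0 \<le> x" "2 * x < p" "0 \<le> y" "2 * y < p"
proof -
  define I where "I = {0..(p - 1) div 2}"
  have p2: "p > 2" using p prime_ge_2_int[of p] by linarith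
  have odd: "odd p" using p prime_odd_int p2 by blast
  have inj: "x = y" if "x \<in> I" "y \<in> I" "p dvd x\<^sup>2 - y\<^sup>2" for x y
  proof -
    have "p dvd (x - y) * (x + y)" using that by (simp add: power2_eq_square algebra_simps)
    then have "p dvd x - y \<or> p dvd x + y" using p prime_dvd_mult_iff by blast
    moreover have "\<bar>x - y\<bar> < p" "x + y < p" "0 \<le> x + y" using that p2 unfolding I_def by auto
    ultimately have "x - y = 0 \<or> x + y = 0" 
      by (metis abs_of_nonneg dvd_imp_le_int linorder_not_le abs_of_pos p2 less_trans zero_less_numeral)
    then show ?thesis using that unfolding I_def by auto
  qed
  let ?f = "\<lambda>x. x\<^sup>2 mod p" and ?g = "\<lambda>y. (- 1 - y\<^sup>2) mod p"
  have f: "inj_on ?f I" by (rule inj_onI) (use inj in \<open>simp add: mod_eq_dvd_iff\<close>)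
  have g: "inj_on ?g I"
  proof (rule inj_onI)
    fix x y assume "x \<in> I" "y \<in> I" "?g x = ?g y"
    then have "p dvd y\<^sup>2 - x\<^sup>2" by (simp add: mod_eq_dvd_iff)
    then show "x = y" using inj[of y x] \<open>x \<in> I\<close> \<open>y \<in> I\<close> by auto
  qed
  have cI: "card I = nat ((p + 1) div 2)" unfolding I_def using p2 by simp
  have "?f ` I \<inter> ?g ` I \<noteq> {}"
  proof
    assume "?f ` I \<inter> ?g ` I = {}"
    then have "card (?f ` I \<union> ?g ` I) = card I + card I"
      using f g by (subst card_Un_disjoint) (auto simp: card_image I_def)
    moreover have "card (?f ` I \<union> ?g ` I) \<le> card {0..<p}"
      by (rule card_mono) (use p2 in auto)
    ultimately show False using cI p2 odd by (auto elim!: oddE)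
  qed
  then obtain x y where xy: "x \<in> I" "y \<in> I" "?f x = ?g y" by fastforce
  then have "p dvd x\<^sup>2 - (- 1 - y\<^sup>2)" by (simp only: mod_eq_dvd_iff)
  then have "p dvd x\<^sup>2 + y\<^sup>2 + 1" by (simp add: algebra_simps)
  then show ?thesis using that[of x y] xy p2 unfolding I_def by auto
qed

lemma four_squares_prime:
  fixes p :: int assumes p: "prime p" shows "four_squares p"
proof (cases "p = 2")
  case True
  have "(2::int) = 1\<^sup>2 + 1\<^sup>2 + 0\<^sup>2 + 0\<^sup>2" by simp
  then show ?thesis unfolding True four_squares_def by blast
next
  case False
  obtain x y where xy: "p dvd x\<^sup>2 + y\<^sup>2 + 1" "0 \<le> x" "2 * x < p" "0 \<le> y" "2 * y < p"
    using prime_dvd_two_squares_plus_one[OF p False] .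
  then obtain m where m: "x\<^sup>2 + y\<^sup>2 + 1 = p * m" by (auto elim: dvdE)
  have p2: "p > 2" using p False prime_ge_2_int[of p] by linarith
  have "0 < p * m" unfolding m[symmetric] by (smt (verit) zero_le_power2)
  then have m0: "0 < m" using p2 by (simp add: zero_less_mult_iff)
  have "(2*x)\<^sup>2 \<le> (p-1)\<^sup>2" "(2*y)\<^sup>2 \<le> (p-1)\<^sup>2" using xy by (intro power_mono; simp)+
  then have "4 * (p * m) \<le> 2 * (p-1)\<^sup>2 + 4" using m by (simp add: power_mult_distrib)
  also have "\<dots> < 4 * (p * p)" using p2 by (simp add: power2_eq_square algebra_simps) (smt (verit) mult_less_cancel_left1 mult_pos_pos)
  finally have "m < p" using p2 by simp
  moreover have "four_squares (m * p)" unfolding four_squares_def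
    by (rule exI[of _ x], rule exI[of _ y], rule exI[of _ 1], rule exI[of _ 0]) (use m in \<open>simp add: algebra_simps\<close>)
  ultimately show ?thesis using four_squares_descent[OF p m0] by blast
qed

theorem four_squares_nonneg:
  assumes "n \<ge> 0" shows "four_squares n"
proof -
  have "four_squares (int k)" for k
  proof (induction k rule: prime_divisors_induct)
    case zero
    show ?case unfolding four_squares_def by (rule exI[of _ 0])+ simp
  next
    case (unit x)
    have "(1::int) = 1\<^sup>2 + 0\<^sup>2 + 0\<^sup>2 + 0\<^sup>2" by simp
    then show ?case using unit unfolding four_squares_def by (metis nat_dvd_1_iff_1 of_nat_1)
  next
    case (factor p x)
    then show ?case using four_squares_mult[OF four_squares_prime] by simp
  qed
  then show ?thesis using assms by (metis nonneg_int_cases)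
qed

section \<open>Translation of a set by steps, and averaging over the starting point\<close>

section \<open>Almost full progressions in sumsets\<close>

text \<open>Walk from u through the steps \<open>vs\<close>. A walk that ends outside A leaves A at
  some step, and it lands there in A' - A, below N because the steps are nonnegative. For each
  position in \<open>vs\<close> the landing point determines u.\<close>

lemma shift_escape_card:
  fixes A A' V :: "int set"
  assumes A: "A \<subseteq> {0..}" and AV: "\<And>u v. u \<in> A \<Longrightarrow> v \<in> V \<Longrightarrow> u + v \<in> A'"
    and V: "V \<subseteq> {0..}" and vs: "set vs \<subseteq> V"
  shows "card {u \<in> A. u + sum_list vs < N \<and> u + sum_list vs \<notin> A}
           \<le> length vs * card ((A' - A) \<inter> {0..<N})"
  using vs
proof (induction vs)
  case Nil
  have "{u \<in> A. u + sum_list [] < N \<and> u + sum_list [] \<notin> A} = {}" by auto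
  then show ?case by (simp only: card.empty)
next
  case (Cons v vs)
  let ?E = "\<lambda>ws. {u \<in> A. u + sum_list ws < N \<and> u + sum_list ws \<notin> A}"
  let ?G = "(A' - A) \<inter> {0..<N}"
  have nn: "0 \<le> sum_list vs" "0 \<le> v" using Cons.prems V by (auto intro!: sum_list_nonneg)
  have fin: "finite (?E vs)"
    by (rule finite_subset[of _ "{0..N}"]) (use A nn in auto)
  have "(\<lambda>u. u + v) ` ?E (v # vs) \<subseteq> ?E vs \<union> ?G"
  proof
    fix y assume "y \<in> (\<lambda>u. u + v) ` ?E (v # vs)"
    then obtain u where u: "u \<in> A" "y = u + v" "y + sum_list vs < N" "y + sum_list vs \<notin> A"
      by (auto simp: algebra_simps)
    have "y \<in> A'" using AV u Cons.prems by simp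
    then show "y \<in> ?E vs \<union> ?G" using u nn A by (cases "y \<in> A") auto
  qed
  then have "card ((\<lambda>u. u + v) ` ?E (v # vs)) \<le> card (?E vs \<union> ?G)"
    by (rule card_mono[rotated]) (use fin in simp)
  also have "\<dots> \<le> card (?E vs) + card ?G" by (rule card_Un_le)
  finally have "card (?E (v # vs)) \<le> card (?E vs) + card ?G"
    by (subst (asm) card_image) (auto intro: inj_onI)
  then show ?case using Cons.IH Cons.prems by simp
qed

text \<open>For fixed k at most h times the number of new elements are starting points u for which u
  + d * k escapes from A. Summing over k <= N / d and exchanging the sums bounds the total number of
  escapes, and the best u in A below H has at most the average.\<close>

lemma exists_almost_full_progression:
  fixes A A' V :: "int set" and d N H :: int
  assumes A: "A \<subseteq> {0..}" and AV: "\<And>u v. u \<in> A \<Longrightarrow> v \<in> V \<Longrightarrow> u + v \<in> A'"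
    and V: "V \<subseteq> {0..}" and d: "d > 0" and N: "N \<ge> 0"
    and basis: "\<And>k. k \<ge> 0 \<Longrightarrow> \<exists>vs. set vs \<subseteq> V \<and> length vs = h \<and> sum_list vs = d * k"
    and ne: "A \<inter> {0..<H} \<noteq> {}"
  shows "\<exists>u \<in> A. u < H \<and>
    card {k. 0 \<le> k \<and> u + d * k < N \<and> u + d * k \<notin> A} * card (A \<inter> {0..<H})
      \<le> h * card ((A' - A) \<inter> {0..<N}) * nat (N div d + 1)"
proof -
  let ?g = "card ((A' - A) \<inter> {0..<N})"
  let ?K = "{0..N div d}"
  let ?bad = "\<lambda>u k. u + d * k < N \<and> u + d * k \<notin> A"
  let ?AH = "A \<inter> {0..<H}"
  define c where "c u = card {k. 0 \<le> k \<and> ?bad u k}" for u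
  have bnd: "k \<in> ?K" if "0 \<le> k" "u + d * k < N" "u \<ge> 0" for u k
  proof -
    have "d * k \<le> N" using that by linarith
    then have "k \<le> N div d" using zdiv_mono1[of "d * k" N d] d by simp
    then show ?thesis using that by simp
  qed
  have c: "c u = (\<Sum>k\<in>?K. if ?bad u k then 1 else 0)" if "u \<in> ?AH" for u
  proof -
    have "{k. 0 \<le> k \<and> ?bad u k} = {k \<in> ?K. ?bad u k}" using bnd[of _ u] that by auto
    then show ?thesis unfolding c_def by (simp add: sum.If_cases Int_def)
  qed
  have "(\<Sum>u\<in>?AH. c u) = (\<Sum>u\<in>?AH. \<Sum>k\<in>?K. if ?bad u k then 1 else 0)"
    using c by simp
  also have "\<dots> = (\<Sum>k\<in>?K. \<Sum>u\<in>?AH. if ?bad u k then 1 else 0)" by (rule sum.swap)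
  also have "\<dots> \<le> (\<Sum>k\<in>?K. h * ?g)"
  proof (rule sum_mono)
    fix k assume "k \<in> ?K"
    then obtain vs where vs: "set vs \<subseteq> V" "length vs = h" "sum_list vs = d * k" using basis by auto
    have "(\<Sum>u\<in>?AH. if ?bad u k then 1 else 0) = card {u \<in> ?AH. ?bad u k}"
      by (simp add: sum.If_cases Int_def)
    also have "\<dots> \<le> card {u \<in> A. ?bad u k}"
    proof (rule card_mono)
      have "d * k \<ge> 0" using \<open>k \<in> ?K\<close> d by simp
      then have "{u \<in> A. ?bad u k} \<subseteq> {0..N}" using A by auto
      then show "finite {u \<in> A. ?bad u k}" by (rule finite_subset) simp
    qed blast
    also have "\<dots> \<le> h * ?g" using shift_escape_card[OF A AV V vs(1), of N] vs by simp
    finally show "(\<Sum>u\<in>?AH. if ?bad u k then 1 else 0) \<le> h * ?g" .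
  qed
  also have "\<dots> = h * ?g * nat (N div d + 1)" by (simp add: algebra_simps)
  finally have le: "(\<Sum>u\<in>?AH. c u) \<le> h * ?g * nat (N div d + 1)" .
  have fin: "finite ?AH" by simp
  define u where "u = arg_min_on c ?AH"
  have u: "u \<in> ?AH" "\<And>v. v \<in> ?AH \<Longrightarrow> c u \<le> c v"
    using arg_min_if_finite[OF fin ne, of c] unfolding u_def by (simp, meson linorder_not_less)
  have "c u * card ?AH \<le> (\<Sum>u\<in>?AH. c u)"
    using sum_bounded_below[of ?AH "c u" c] u by (simp add: mult.commute)
  with le have "c u * card ?AH \<le> h * ?g * nat (N div d + 1)" by linarith
  then show ?thesis unfolding c_def using u(1) by (intro bexI[of _ u]) simp_all
qed

section \<open>Second moment of the number of representations by three quadratic polynomials\<close>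

section \<open>Positive density of ternary sums\<close>

text \<open>Cauchy-Schwarz against the constant 1, read off from the nonnegative sum of squared
  deviations from the mean c.\<close>

lemma square_sum_le_card_mult_sum_squares:
  fixes r :: "'a \<Rightarrow> real"
  assumes "finite I"
  shows "(\<Sum>i\<in>I. r i)\<^sup>2 \<le> card I * (\<Sum>i\<in>I. (r i)\<^sup>2)"
proof (cases "I = {}")
  case False
  define n where "n = real (card I)"
  have n: "n > 0" unfolding n_def using False assms by (simp add: card_gt_0_iff)
  define c where "c = (\<Sum>i\<in>I. r i) / n"
  have c: "(\<Sum>i\<in>I. r i) = c * n" unfolding c_def using n by simp
  have "0 \<le> (\<Sum>i\<in>I. (r i - c)\<^sup>2)" by (simp add: sum_nonneg)
  also have "\<dots> = (\<Sum>i\<in>I. (r i)\<^sup>2 + (c\<^sup>2 - 2 * c * r i))" by (simp add: power2_diff algebra_simps)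
  also have "\<dots> = (\<Sum>i\<in>I. (r i)\<^sup>2) + (n * c\<^sup>2 - 2 * c * (c * n))"
    using c by (simp add: sum.distrib sum_subtractf n_def flip: sum_distrib_left)
  finally have "n * (n * c\<^sup>2) \<le> n * (\<Sum>i\<in>I. (r i)\<^sup>2)" using n by (intro mult_left_mono) (simp_all add: power2_eq_square mult.left_commute mult.commute)
  then show ?thesis unfolding c n_def[symmetric] by (simp add: power_mult_distrib power2_eq_square algebra_simps)
qed simp

text \<open>The fibre sizes sum to the size of T and their squares sum to the number of colliding
  pairs, so few collisions force a large image.\<close>

lemma card_square_le_card_image_collisions:
  assumes "finite T"
  shows "(card T)\<^sup>2 \<le> card (f ` T) * card {(x, y) \<in> T \<times> T. f x = f y}"
proof -
  let ?r = "\<lambda>n. card {x \<in> T. f x = n}"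
  have T: "card T = (\<Sum>n\<in>f ` T. ?r n)"
    using sum.group[of T "f ` T" f "\<lambda>_. 1::nat"] assms by simp
  have "{(x, y) \<in> T \<times> T. f x = f y} = (\<Union>n\<in>f ` T. {x \<in> T. f x = n} \<times> {x \<in> T. f x = n})" by auto
  then have Z: "card {(x, y) \<in> T \<times> T. f x = f y} = (\<Sum>n\<in>f ` T. (?r n)\<^sup>2)"
    by (simp only:) (subst card_UN_disjoint, use assms in \<open>auto simp: card_cartesian_product power2_eq_square\<close>)
  have "(\<Sum>n\<in>f ` T. real (?r n))\<^sup>2 \<le> card (f ` T) * (\<Sum>n\<in>f ` T. (real (?r n))\<^sup>2)"
    using assms by (intro square_sum_le_card_mult_sum_squares) simp
  then have "real ((card T)\<^sup>2) \<le> real (card (f ` T) * card {(x, y) \<in> T \<times> T. f x = f y})"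
    unfolding T Z by simp
  then show ?thesis by (simp only: of_nat_le_iff)
qed

section \<open>Linear congruences and equations in a box, and sums of gcds\<close>

lemma card_congruent_le:
  fixes S :: "int set" and X m :: int
  assumes "S \<subseteq> {0..<X}" "m > 0" "X \<ge> 0" "\<And>x y. x \<in> S \<Longrightarrow> y \<in> S \<Longrightarrow> m dvd x - y"
  shows "real (card S) \<le> X / m + 1"
proof -
  have "inj_on (\<lambda>x. x div m) S"
  proof (rule inj_onI)
    fix x y assume "x \<in> S" "y \<in> S" "x div m = y div m"
    moreover from this have "x mod m = y mod m" using assms by (simp add: mod_eq_dvd_iff)
    ultimately show "x = y" by (metis div_mult_mod_eq)
  qed
  then have "card S = card ((\<lambda>x. x div m) ` S)" by (simp add: card_image)
  also have "\<dots> \<le> card {0..X div m}"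
    by (rule card_mono) (use assms in \<open>auto simp: pos_imp_zdiv_nonneg_iff zdiv_mono1\<close>)
  also have "\<dots> = nat (X div m + 1)" by simp
  finally have "card S \<le> nat (X div m + 1)" .
  moreover have "0 \<le> X div m" using assms by (simp add: pos_imp_zdiv_nonneg_iff)
  ultimately have "int (card S) \<le> X div m + 1" by linarith
  moreover have "real_of_int (X div m) \<le> X / m" by (rule real_of_int_div4)
  ultimately show ?thesis by linarith
qed

lemma card_linear_congruence_le:
  fixes X m c k :: int
  assumes "m > 0" "X \<ge> 0"
  shows "real (card {y \<in> {0..<X}. m dvd c * y - k}) \<le> X * gcd c m / m + 1"
proof -
  define g where "g = gcd c m"
  have g: "g > 0" unfolding g_def using assms by (simp add: gcd_pos_int)
  have mg: "m div g > 0" using assms g unfolding g_def by (simp add: pos_imp_zdiv_pos_iff zdvd_imp_le)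
  have co: "coprime (c div g) (m div g)" unfolding g_def using assms by (intro div_gcd_coprime) auto
  have "real (card {y \<in> {0..<X}. m dvd c * y - k}) \<le> X / (m div g) + 1"
  proof (rule card_congruent_le)
    fix x y assume "x \<in> {y \<in> {0..<X}. m dvd c * y - k}" "y \<in> {y \<in> {0..<X}. m dvd c * y - k}"
    then have "m dvd (c * x - k) - (c * y - k)" by (blast intro: dvd_diff)
    then have "m dvd c * (x - y)" by (simp add: algebra_simps)
    then have "g * (m div g) dvd g * ((c div g) * (x - y))" unfolding g_def 
      by (metis dvd_mult_div_cancel gcd_dvd1 gcd_dvd2 mult.assoc)
    then have "m div g dvd (c div g) * (x - y)" using g by simp
    then show "m div g dvd x - y" using co by (simp add: coprime_commute coprime_dvd_mult_right_iff)
  qed (use assms mg in auto)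
  also have "real_of_int (m div g) = m / g" unfolding g_def by (simp add: real_of_int_div)
  finally show ?thesis unfolding g_def by simp
qed

text \<open>With g the gcd of all three coefficients and G = gcd c1 c2, y3 lies in at most one class
  modulo G / g; given y3, y2 lies in at most one class modulo |c1| / G; then y1 is determined. The
  bound on |c1| absorbs the two summands 1: each of the four products is at most q * X^2 * g /
  |c1|.\<close>

lemma card_linear_equation_le:
  fixes c1 c2 c3 k X q :: int
  assumes c1: "c1 \<noteq> 0" "\<bar>c1\<bar> \<le> q * X" and X: "X \<ge> 1" and q: "q \<ge> 1"
  shows "real (card {(y1, y2, y3). {y1, y2, y3} \<subseteq> {0..<X} \<and> c1 * y1 + c2 * y2 + c3 * y3 = k})
          \<le> 4 * q * X\<^sup>2 * gcd c1 (gcd c2 c3) / \<bar>c1\<bar>"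
proof -
  let ?S = "{(y1, y2, y3). {y1, y2, y3} \<subseteq> {0..<X} \<and> c1 * y1 + c2 * y2 + c3 * y3 = k}"
  define G where "G = gcd c1 c2"
  define g where "g = gcd c1 (gcd c2 c3)"
  have G: "G > 0" unfolding G_def using c1 by (simp add: gcd_pos_int)
  have g: "g \<ge> 1" unfolding g_def using c1 by (smt (verit) gcd_pos_int)
  have gG: "gcd c3 G = g" unfolding G_def g_def by (simp add: gcd.assoc gcd.commute gcd.left_commute)
  have Gc1: "G \<le> \<bar>c1\<bar>" unfolding G_def using c1 by (simp add: zdvd_imp_le)
  define S3 where "S3 = {y \<in> {0..<X}. G dvd c3 * y - k}"
  define S2 where "S2 y3 = {y \<in> {0..<X}. \<bar>c1\<bar> dvd c2 * y - (k - c3 * y3)}" for y3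
  have fS2: "finite (S2 y)" for y unfolding S2_def by (rule finite_subset[of _ "{0..<X}"]) auto
  have fS3: "finite S3" unfolding S3_def by (rule finite_subset[of _ "{0..<X}"]) auto
  let ?pr = "\<lambda>(y1::int, y2::int, y3::int). (y3, y2)"
  have inj: "inj_on ?pr ?S"
    by (rule inj_onI) (use c1 in \<open>auto split: prod.splits\<close>)
  have sub: "?pr ` ?S \<subseteq> Sigma S3 S2"
  proof
    fix z assume "z \<in> ?pr ` ?S"
    then obtain y1 y2 y3 where z: "z = (y3, y2)" "{y1, y2, y3} \<subseteq> {0..<X}"
      and k: "c1 * y1 + c2 * y2 + c3 * y3 = k" by auto
    have "G dvd - (c1 * y1 + c2 * y2)" unfolding G_def by (simp only: dvd_minus_iff dvd_add dvd_mult2 gcd_dvd1 gcd_dvd2)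
    moreover have "c3 * y3 - k = - (c1 * y1 + c2 * y2)" using k by simp
    moreover have "c2 * y2 - (k - c3 * y3) = c1 * (- y1)" using k by (simp add: algebra_simps)
    ultimately have "G dvd c3 * y3 - k" "\<bar>c1\<bar> dvd c2 * y2 - (k - c3 * y3)" by (simp_all only: abs_dvd_iff dvd_triv_left)
    then show "z \<in> Sigma S3 S2" using z unfolding S3_def S2_def by simp
  qed
  have "card ?S = card (?pr ` ?S)" using inj by (simp add: card_image)
  also have "\<dots> \<le> card (Sigma S3 S2)" by (rule card_mono) (use fS2 fS3 sub in auto)
  also have "\<dots> = (\<Sum>y\<in>S3. card (S2 y))" using fS2 fS3 by (simp add: card_SigmaI)
  finally have "real (card ?S) \<le> (\<Sum>y\<in>S3. real (card (S2 y)))" by (simp flip: of_nat_sum)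
  also have "\<dots> \<le> (\<Sum>y\<in>S3. X * G / \<bar>c1\<bar> + 1)"
  proof (rule sum_mono)
    fix y show "real (card (S2 y)) \<le> X * G / \<bar>c1\<bar> + 1"
      unfolding S2_def G_def using card_linear_congruence_le[of "\<bar>c1\<bar>" X c2 "k - c3 * y"] c1 X
      by (simp add: gcd.commute)
  qed
  also have "\<dots> = card S3 * (X * G / \<bar>c1\<bar> + 1)" by simp
  also have "\<dots> \<le> (X * g / G + 1) * (X * G / \<bar>c1\<bar> + 1)"
  proof (rule mult_right_mono)
    show "real (card S3) \<le> X * g / G + 1"
      unfolding S3_def using card_linear_congruence_le[of G X c3 k] G X gG by simp
  qed (use X G in simp)
  also have "\<dots> \<le> 4 * q * X\<^sup>2 * g / \<bar>c1\<bar>"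
  proof -
    define x :: real where "x = X"
    define r :: real where "r = \<bar>c1\<bar>"
    define s :: real where "s = g"
    define t :: real where "t = G"
    define p :: real where "p = q"
    have x: "x \<ge> 1" and r: "r \<ge> t" and s: "s \<ge> 1" and t: "t \<ge> 1" and p: "p \<ge> 1" and rp: "r \<le> p * x"
      using X c1 g G Gc1 q unfolding x_def r_def s_def t_def p_def by (simp_all flip: of_int_mult)
    have r0: "r > 0" using r t by linarith
    have e: "(x * s / t + 1) * (x * t / r + 1) * r = x * s * x + x * s * (r / t) + x * t + r"
      using r0 t by (simp add: field_simps)
    have b1: "x * s * x \<le> p * x\<^sup>2 * s" using p x s by (simp add: power2_eq_square mult.commute)
    have "r / t \<le> r" using t r0 by (simp add: divide_le_eq)
    then have "r / t \<le> p * x" using rp by linarith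
    then have "x * s * (r / t) \<le> x * s * (p * x)" by (rule mult_left_mono) (use x s in simp)
    then have b2: "x * s * (r / t) \<le> p * x\<^sup>2 * s" by (simp add: power2_eq_square algebra_simps)
    have "x * t \<le> x * (p * x)" using r rp x by (intro mult_left_mono) linarith+
    also have "\<dots> \<le> x * (p * x) * s" using s x p by simp
    finally have b3: "x * t \<le> p * x\<^sup>2 * s" by (simp add: power2_eq_square algebra_simps)
    have "r \<le> p * x * 1" using rp by simp
    also have "\<dots> \<le> p * x * (x * s)" using x p s by (intro mult_left_mono) (simp_all add: mult_ge1_I)
    finally have b4: "r \<le> p * x\<^sup>2 * s" by (simp add: power2_eq_square algebra_simps)
    have "(x * s / t + 1) * (x * t / r + 1) * r \<le> 4 * p * x\<^sup>2 * s" unfolding e using b1 b2 b3 b4 by linarith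
    then have "(x * s / t + 1) * (x * t / r + 1) \<le> 4 * p * x\<^sup>2 * s / r" using r0 by (simp add: pos_le_divide_eq)
    then show ?thesis unfolding x_def r_def s_def t_def p_def by simp
  qed
  finally show ?thesis unfolding g_def .
qed

lemma sum_inverse_squares_le: "(\<Sum>g\<in>{1..n}. 1 / (real_of_int g)\<^sup>2) \<le> 2"
proof -
  have "(\<Sum>g\<in>{1..int (Suc k)}. 1 / (real_of_int g)\<^sup>2) \<le> 2 - 1 / real (Suc k)" for k
  proof (induction k)
    case (Suc k)
    have "{1..int (Suc (Suc k))} = insert (int (Suc (Suc k))) {1..int (Suc k)}" by auto
    then have "(\<Sum>g\<in>{1..int (Suc (Suc k))}. 1 / (real_of_int g)\<^sup>2)
       = 1 / (real (Suc (Suc k)))\<^sup>2 + (\<Sum>g\<in>{1..int (Suc k)}. 1 / (real_of_int g)\<^sup>2)" by simp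
    also have "\<dots> \<le> 1 / (real (Suc (Suc k)))\<^sup>2 + (2 - 1 / real (Suc k))" using Suc by linarith
    also have "\<dots> \<le> 2 - 1 / real (Suc (Suc k))"
    proof -
      define t where "t = real (Suc k)"
      have "t > 0" "real (Suc (Suc k)) = t + 1" unfolding t_def by simp_all
      moreover have "1 / (t + 1)\<^sup>2 \<le> 1 / (t * (t + 1))" if "t > 0"
        using that by (intro divide_left_mono) (simp_all add: power2_eq_square)
      moreover have "1 / (t * (t + 1)) = 1 / t - 1 / (t + 1)" if "t > 0"
        using that by (simp add: field_simps)
      ultimately have "1 / (t + 1)\<^sup>2 + (2 - 1 / t) \<le> 2 - 1 / (t + 1)" by linarith
      then show ?thesis using \<open>real (Suc (Suc k)) = t + 1\<close> unfolding t_def by simp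
    qed
    finally show ?case .
  qed simp
  from this[of "nat (n - 1)"] show ?thesis
    by (cases "n \<ge> 1") (auto intro: order_trans)
qed

text \<open>The gcd is at most the sum of all common divisors g. After exchanging the sums, g
  contributes g times the square of the number of its multiples in [-U, U], hence at most g * (3 * U
  / g)^2.\<close>

lemma gcd_sum_le:
  fixes U :: int assumes U: "U > 0"
  shows "(\<Sum>v\<in>{-U..U}. \<Sum>w\<in>{-U..U}. real_of_int (gcd U (gcd v w)))
     \<le> 9 * U\<^sup>2 * (\<Sum>g\<in>{g\<in>{1..U}. g dvd U}. 1 / g)"
proof -
  let ?D = "{g\<in>{1..U}. g dvd U}" and ?R = "{-U..U}"
  have "(\<Sum>v\<in>?R. \<Sum>w\<in>?R. real_of_int (gcd U (gcd v w)))
     \<le> (\<Sum>v\<in>?R. \<Sum>w\<in>?R. \<Sum>g\<in>?D. (if g dvd v then 1 else 0) * (if g dvd w then 1 else 0) * real_of_int g)"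
  proof (intro sum_mono)
    fix v w
    let ?t = "\<lambda>g::int. (if g dvd v then 1 else 0) * (if g dvd w then 1 else 0) * real_of_int g"
    let ?g = "gcd U (gcd v w)"
    have "?g > 0" using U by (simp add: gcd_pos_int)
    then have "?g \<in> ?D" using U by (simp add: zdvd_imp_le)
    then have "?t ?g \<le> (\<Sum>g\<in>?D. ?t g)" by (intro member_le_sum) auto
    moreover have "?g dvd v" "?g dvd w" by (meson dvd_trans gcd_dvd1 gcd_dvd2)+
    ultimately show "real_of_int ?g \<le> (\<Sum>g\<in>?D. ?t g)" by simp
  qed
  also have "\<dots> = (\<Sum>v\<in>?R. \<Sum>g\<in>?D. \<Sum>w\<in>?R. (if g dvd v then 1 else 0) * (if g dvd w then 1 else 0) * real_of_int g)"
    by (intro sum.cong refl sum.swap)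
  also have "\<dots> = (\<Sum>g\<in>?D. \<Sum>v\<in>?R. \<Sum>w\<in>?R. (if g dvd v then 1 else 0) * (if g dvd w then 1 else 0) * real_of_int g)"
    by (rule sum.swap)
  also have "\<dots> = (\<Sum>g\<in>?D. (\<Sum>v\<in>?R. if g dvd v then 1 else 0)\<^sup>2 * real_of_int g)"
    unfolding power2_eq_square sum_product by (simp only: sum_distrib_right)
  also have "\<dots> \<le> (\<Sum>g\<in>?D. 9 * U\<^sup>2 * (1 / g))"
  proof (rule sum_mono)
    fix g assume g: "g \<in> ?D"
    then obtain k where k: "U = g * k" by (auto elim: dvdE)
    have k0: "k \<ge> 1" using k U g by (smt (verit) mem_Collect_eq atLeastAtMost_iff zero_less_mult_pos)
    have "{v \<in> ?R. g dvd v} = (\<lambda>j. g * j) ` {-k..k}"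
    proof (intro equalityI subsetI)
      fix v assume "v \<in> {v \<in> ?R. g dvd v}"
      then obtain j where j: "v = g * j" "- (g * k) \<le> g * j" "g * j \<le> g * k" using k by (auto elim: dvdE)
      have "g > 0" using g by simp
      then have "j \<le> k" "-k \<le> j" using j by (simp_all flip: mult_minus_right)
      then show "v \<in> (\<lambda>j. g * j) ` {-k..k}" using j by auto
    next
      fix v assume "v \<in> (\<lambda>j. g * j) ` {-k..k}"
      then obtain j where "v = g * j" "j \<in> {-k..k}" by blast
      moreover have "g > 0" using g by simp
      ultimately show "v \<in> {v \<in> ?R. g dvd v}" unfolding k by (simp flip: mult_minus_right)
    qed
    then have "card {v \<in> ?R. g dvd v} \<le> card {-k..k}"
      by (simp only: card_image_le finite_atLeastAtMost_int)
    then have "real (card {v \<in> ?R. g dvd v}) \<le> 3 * k" using k0 by simp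
    then have "(real (card {v \<in> ?R. g dvd v}))\<^sup>2 \<le> (3 * real_of_int k)\<^sup>2" by (intro power_mono) auto
    then have "(real (card {v \<in> ?R. g dvd v}))\<^sup>2 * g \<le> (3 * real_of_int k)\<^sup>2 * g" using g by (intro mult_right_mono) auto
    also have "(3 * real_of_int k)\<^sup>2 * real_of_int g = 9 * U\<^sup>2 * (1 / g)" using g by (simp add: k power2_eq_square field_simps)
    finally show "(\<Sum>v\<in>?R. if g dvd v then 1 else 0)\<^sup>2 * real_of_int g \<le> 9 * U\<^sup>2 * (1 / g)"
      by (simp add: sum.If_cases Int_def)
  qed
  also have "\<dots> = 9 * U\<^sup>2 * (\<Sum>g\<in>?D. 1 / g)" by (simp add: sum_distrib_left)
  finally show ?thesis .
qed

text \<open>After one more exchange of sums, g divides at most X / g of the U, and the sum of 1 /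
  g^2 appears. Its convergence keeps a logarithm out of the bound, without which the density would
  not be positive.\<close>

lemma gcd_sum_total_le:
  fixes X :: int assumes X: "X \<ge> 1"
  shows "(\<Sum>U\<in>{1..<X}. (\<Sum>v\<in>{-U..U}. \<Sum>w\<in>{-U..U}. real_of_int (gcd U (gcd v w))) / U) \<le> 18 * X\<^sup>2"
proof -
  let ?D = "\<lambda>U. {g\<in>{1..U}. g dvd U}"
  have "(\<Sum>U\<in>{1..<X}. (\<Sum>v\<in>{-U..U}. \<Sum>w\<in>{-U..U}. real_of_int (gcd U (gcd v w))) / U)
     \<le> (\<Sum>U\<in>{1..<X}. 9 * X * (\<Sum>g\<in>{1..X}. if g dvd U then 1 / g else 0))"
  proof (rule sum_mono)
    fix U assume U: "U \<in> {1..<X}"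
    have "(\<Sum>v\<in>{-U..U}. \<Sum>w\<in>{-U..U}. real_of_int (gcd U (gcd v w))) / U \<le> 9 * U\<^sup>2 * (\<Sum>g\<in>?D U. 1 / g) / U"
      using gcd_sum_le[of U] U by (intro divide_right_mono) auto
    also have "\<dots> = 9 * U * (\<Sum>g\<in>?D U. 1 / g)" using U by (simp add: power2_eq_square)
    also have "\<dots> \<le> 9 * X * (\<Sum>g\<in>?D U. 1 / g)" using U by (intro mult_right_mono sum_nonneg) auto
    also have "(\<Sum>g\<in>?D U. 1 / real_of_int g) = (\<Sum>g\<in>{g\<in>{1..X}. g dvd U}. 1 / g)"
      by (rule sum.cong) (use U in \<open>auto dest: zdvd_imp_le\<close>)
    also have "\<dots> = (\<Sum>g\<in>{1..X}. if g dvd U then 1 / g else 0)"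
      by (simp add: sum.If_cases Int_def)
    finally show "(\<Sum>v\<in>{-U..U}. \<Sum>w\<in>{-U..U}. real_of_int (gcd U (gcd v w))) / U
      \<le> 9 * X * (\<Sum>g\<in>{1..X}. if g dvd U then 1 / g else 0)" by simp
  qed
  also have "\<dots> = 9 * X * (\<Sum>g\<in>{1..X}. \<Sum>U\<in>{1..<X}. if g dvd U then 1 / g else 0)"
    by (subst sum.swap) (simp add: sum_distrib_left)
  also have "\<dots> \<le> 9 * X * (\<Sum>g\<in>{1..X}. X * (1 / g\<^sup>2))"
  proof (intro mult_left_mono sum_mono)
    fix g assume g: "g \<in> {1..X}"
    have "inj_on (\<lambda>U. U div g) {U \<in> {1..<X}. g dvd U}"
      by (rule inj_onI) (use g in auto)
    moreover have "(\<lambda>U. U div g) ` {U \<in> {1..<X}. g dvd U} \<subseteq> {1..X div g}"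
    proof
      fix z assume "z \<in> (\<lambda>U. U div g) ` {U \<in> {1..<X}. g dvd U}"
      then obtain U where U: "z = U div g" "1 \<le> U" "U < X" "g dvd U" by auto
      have "g \<le> U" using U by (simp add: zdvd_imp_le)
      then show "z \<in> {1..X div g}" using U g zdiv_mono1[of U X g] zdiv_mono1[of g U g] by simp
    qed
    ultimately have "card {U \<in> {1..<X}. g dvd U} \<le> card {1..X div g}"
      by (metis card_image card_mono finite_atLeastAtMost_int)
    then have "card {U \<in> {1..<X}. g dvd U} \<le> nat (X div g)" by simp
    moreover have "0 \<le> X div g" using g X by (simp add: pos_imp_zdiv_nonneg_iff)
    ultimately have "int (card {U \<in> {1..<X}. g dvd U}) \<le> X div g" by linarith
    moreover have "real_of_int (X div g) \<le> X / g" by (rule real_of_int_div4)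
    ultimately have c: "real (card {U \<in> {1..<X}. g dvd U}) \<le> X / g" by linarith
    have "(\<Sum>U\<in>{1..<X}. if g dvd U then 1 / real_of_int g else 0) = card {U \<in> {1..<X}. g dvd U} * (1 / g)"
      by (simp add: sum.If_cases Int_def)
    also have "\<dots> \<le> (X / g) * (1 / g)" using c g by (intro mult_right_mono) auto
    finally show "(\<Sum>U\<in>{1..<X}. if g dvd U then 1 / real_of_int g else 0) \<le> X * (1 / g\<^sup>2)"
      by (simp add: power2_eq_square)
  qed (use X in auto)
  also have "\<dots> = 9 * X * (X * (\<Sum>g\<in>{1..X}. 1 / (real_of_int g)\<^sup>2))" by (simp add: sum_distrib_left)
  also have "\<dots> \<le> real_of_int (9 * X) * (real_of_int X * 2)"
    using sum_inverse_squares_le[of X] X by (intro mult_left_mono) auto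
  finally show ?thesis by (simp add: power2_eq_square)
qed

section \<open>Value sets over finite index sets\<close>

lemma polygonal_nonneg:
  assumes "m \<ge> 3" shows "polygonal m x \<ge> 0"
proof -
  \<comment> \<open>A decomposition into products of two consecutive integers, which are
    nonnegative, with coefficients that are nonnegative for m >= 3.\<close>
  have "2 * polygonal m x = (int m - 3) * (x * (x - 1)) + x * (x + 1)"
    unfolding two_times_polygonal by (simp add: algebra_simps power2_eq_square)
  moreover have "x * (x - 1) \<ge> 0" "x * (x + 1) \<ge> 0"
    by (simp_all add: zero_le_mult_iff; linarith)+
  moreover have "(int m - 3) * (x * (x - 1)) \<ge> 0" using assms by (intro mult_nonneg_nonneg[OF _ \<open>x * (x - 1) \<ge> 0\<close>]) auto
  ultimately show ?thesis by linarith
qed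

lemma polygonal_0 [simp]: "polygonal m 0 = 0"
  by (simp add: polygonal_def)

text \<open>The terms are indexed by natural numbers and not stored in a list, so that disjoint
  blocks of one infinite branch can be combined and enlarged.\<close>

definition reps :: "(nat \<Rightarrow> nat) \<Rightarrow> (nat \<Rightarrow> nat) \<Rightarrow> nat set \<Rightarrow> int set" where
  "reps a m J = range (\<lambda>x. \<Sum>j\<in>J. int (a j) * polygonal (m j) (x j))"

lemma repsI: "n = (\<Sum>j\<in>J. int (a j) * polygonal (m j) (x j)) \<Longrightarrow> n \<in> reps a m J"
  by (auto simp: reps_def)

lemma reps_nonneg:
  assumes "\<And>j. j \<in> J \<Longrightarrow> m j \<ge> 3" shows "reps a m J \<subseteq> {0..}"
  unfolding reps_def using assms by (auto intro!: sum_nonneg mult_nonneg_nonneg polygonal_nonneg)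

lemma zero_in_reps: "0 \<in> reps a m J"
  by (rule repsI[where x = "\<lambda>_. 0"]) simp

lemma reps_Un_add:
  assumes "finite J" "finite K" "J \<inter> K = {}" "u \<in> reps a m J" "v \<in> reps a m K"
  shows "u + v \<in> reps a m (J \<union> K)"
proof -
  obtain x y where x: "u = (\<Sum>j\<in>J. int (a j) * polygonal (m j) (x j))"
    and y: "v = (\<Sum>j\<in>K. int (a j) * polygonal (m j) (y j))"
    using assms unfolding reps_def by blast
  define z where "z j = (if j \<in> J then x j else y j)" for j
  have "(\<Sum>j\<in>J \<union> K. int (a j) * polygonal (m j) (z j))
    = (\<Sum>j\<in>J. int (a j) * polygonal (m j) (z j)) + (\<Sum>j\<in>K. int (a j) * polygonal (m j) (z j))"
    using assms by (simp add: sum.union_disjoint)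
  also have "(\<Sum>j\<in>J. int (a j) * polygonal (m j) (z j)) = u"
    unfolding x z_def by (rule sum.cong) auto
  also have "(\<Sum>j\<in>K. int (a j) * polygonal (m j) (z j)) = v"
    unfolding y z_def by (rule sum.cong) (use assms in auto)
  finally show ?thesis by (intro repsI[where x = z]) simp
qed

lemma reps_mono:
  assumes "finite K" "J \<subseteq> K" shows "reps a m J \<subseteq> reps a m K"
proof
  fix u assume u: "u \<in> reps a m J"
  have "u + 0 \<in> reps a m (J \<union> (K - J))"
    using assms by (intro reps_Un_add u zero_in_reps) (auto intro: finite_subset)
  then show "u \<in> reps a m K" using assms by (simp add: Un_absorb1)
qed

text \<open>Collisions off the diagonal are sorted by the variable with the largest difference;
  permuting the three functions reduces all of them to this case. The largest difference is nonzero,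
  and it limits the choices for the other two differences, which compensates for the size of the
  intervals in the linear count.\<close>

definition dominant_collisions :: "(int \<Rightarrow> int) \<Rightarrow> (int \<Rightarrow> int) \<Rightarrow> (int \<Rightarrow> int) \<Rightarrow> int
    \<Rightarrow> ((int \<times> int \<times> int) \<times> (int \<times> int \<times> int)) set" where
  "dominant_collisions f1 f2 f3 X = {((x1, x2, x3), (y1, y2, y3)).
     {x1, x2, x3, y1, y2, y3} \<subseteq> {0..<X} \<and> f1 x1 + f2 x2 + f3 x3 = f1 y1 + f2 y2 + f3 y3 \<and>
     x1 \<noteq> y1 \<and> \<bar>x2 - y2\<bar> \<le> \<bar>x1 - y1\<bar> \<and> \<bar>x3 - y3\<bar> \<le> \<bar>x1 - y1\<bar>}"

lemma finite_dominant_collisions: "finite (dominant_collisions f1 f2 f3 X)"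
  by (rule finite_subset[of _ "({0..<X} \<times> {0..<X} \<times> {0..<X}) \<times> ({0..<X} \<times> {0..<X} \<times> {0..<X})"])
    (auto simp: dominant_collisions_def)

text \<open>For fixed differences u_i = x_i - y_i a collision is a linear equation in the y_i with
  coefficients 2 * A_i * u_i. The number q serves twice: |2 * A1 * u1| <= q * X, and the gcd of the
  coefficients divides q times the gcd of the u_i. Summing over u gives the gcd sum for positive and
  for negative u1, hence 144 = 4 * (18 + 18).\<close>

lemma card_dominant_collisions_le:
  fixes A1 A2 A3 B1 B2 B3 X :: int
  assumes A: "A1 > 0" "A2 > 0" "A3 > 0" and X: "X \<ge> 1"
  defines "q \<equiv> 2 * A1 * A2 * A3"
  shows "real (card (dominant_collisions (\<lambda>x. A1 * x\<^sup>2 + B1 * x) (\<lambda>x. A2 * x\<^sup>2 + B2 * x) (\<lambda>x. A3 * x\<^sup>2 + B3 * x) X))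
    \<le> 144 * q\<^sup>2 * X ^ 4"
    (is "real (card ?Z) \<le> _")
proof -
  define R where "R u = {-\<bar>u\<bar>..\<bar>u\<bar>}" for u :: int
  define U1 where "U1 = {1..<X} \<union> uminus ` {1..<X}"
  define U where "U = (SIGMA u1:U1. R u1 \<times> R u1)"
  define k where "k u1 u2 u3 = - (A1 * u1\<^sup>2 + B1 * u1 + A2 * u2\<^sup>2 + B2 * u2 + A3 * u3\<^sup>2 + B3 * u3)" for u1 u2 u3
  define S where "S = (\<lambda>(u1, u2, u3). {(y1, y2, y3). {y1, y2, y3} \<subseteq> {0..<X} \<and>
      (2 * A1 * u1) * y1 + (2 * A2 * u2) * y2 + (2 * A3 * u3) * y3 = k u1 u2 u3})"
  have fU: "finite U" unfolding U_def U1_def R_def by auto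
  have fS: "finite (S u)" for u
    unfolding S_def by (rule finite_subset[of _ "{0..<X} \<times> {0..<X} \<times> {0..<X}"]) (auto split: prod.splits)
  have q1: "q \<ge> 1" "q \<ge> 2 * A1"
  proof -
    have "0 < A2 * A3" using A by simp
    then have "A2 * A3 \<ge> 1" by linarith
    then have "2 * A1 * 1 \<le> 2 * A1 * (A2 * A3)" using A by (intro mult_left_mono) auto
    then show "q \<ge> 2 * A1" unfolding q_def by (simp add: mult.assoc)
    then show "q \<ge> 1" using A by simp
  qed
  let ?d = "\<lambda>((x1, x2, x3), (y1, y2, y3)). ((x1 - y1, x2 - y2, x3 - y3), (y1, y2, y3 :: int))"
  have inj: "inj_on ?d ?Z" by (rule inj_onI) (auto split: prod.splits)
  have sub: "?d ` ?Z \<subseteq> Sigma U S"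
  proof
    fix z assume "z \<in> ?d ` ?Z"
    then obtain p where p: "p \<in> ?Z" "z = ?d p" by blast
    obtain x1 x2 x3 y1 y2 y3 where "p = ((x1, x2, x3), (y1, y2, y3))" by (metis surj_pair)
    with p have z: "z = ((x1 - y1, x2 - y2, x3 - y3), (y1, y2, y3))"
      and box: "{x1, x2, x3, y1, y2, y3} \<subseteq> {0..<X}"
      and eq: "A1 * x1\<^sup>2 + B1 * x1 + (A2 * x2\<^sup>2 + B2 * x2) + (A3 * x3\<^sup>2 + B3 * x3)
         = A1 * y1\<^sup>2 + B1 * y1 + (A2 * y2\<^sup>2 + B2 * y2) + (A3 * y3\<^sup>2 + B3 * y3)"
      and dom: "x1 \<noteq> y1" "\<bar>x2 - y2\<bar> \<le> \<bar>x1 - y1\<bar>" "\<bar>x3 - y3\<bar> \<le> \<bar>x1 - y1\<bar>"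
      unfolding dominant_collisions_def by simp_all
    have "x1 - y1 \<in> U1"
    proof (cases "x1 > y1")
      case True then show ?thesis using box unfolding U1_def by auto
    next
      case False
      then have "x1 - y1 = - (y1 - x1)" "y1 - x1 \<in> {1..<X}" using box dom by auto
      then show ?thesis unfolding U1_def by blast
    qed
    moreover have "(y1, y2, y3) \<in> S (x1 - y1, x2 - y2, x3 - y3)"
      using box eq unfolding S_def k_def by (simp add: power2_eq_square algebra_simps)
    ultimately show "z \<in> Sigma U S" using dom unfolding z U_def R_def by auto
  qed
  have "finite (Sigma U S)" using fU fS by (rule finite_SigmaI)
  then have "card ?Z \<le> card (Sigma U S)" by (rule card_inj_on_le[OF inj sub])
  also have "\<dots> = (\<Sum>u\<in>U. card (S u))" using fU fS by (simp add: card_SigmaI)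
  finally have "real (card ?Z) \<le> (\<Sum>u\<in>U. real (card (S u)))" by (simp flip: of_nat_sum)
  also have "\<dots> \<le> (\<Sum>(u1, u2, u3)\<in>U. 4 * q\<^sup>2 * X\<^sup>2 * (gcd \<bar>u1\<bar> (gcd u2 u3) / \<bar>u1\<bar>))"
  proof (rule sum_mono, clarify)
    fix u1 u2 u3 assume "(u1, u2, u3) \<in> U"
    then have u: "u1 \<noteq> 0" "\<bar>u1\<bar> \<le> X" unfolding U_def U1_def by auto
    let ?g = "gcd (2 * A1 * u1) (gcd (2 * A2 * u2) (2 * A3 * u3))"
    have "\<bar>2 * A1 * u1\<bar> = (2 * A1) * \<bar>u1\<bar>" using A by (simp add: abs_mult)
    also have "\<dots> \<le> q * X" using q1 u A by (intro mult_mono) auto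
    finally have bound: "\<bar>2 * A1 * u1\<bar> \<le> q * X" .
    have "2 * A1 * u1 \<noteq> 0" using u A by simp
    then have "real (card (S (u1, u2, u3))) \<le> 4 * q * X\<^sup>2 * ?g / \<bar>2 * A1 * u1\<bar>"
      unfolding S_def prod.case by (rule card_linear_equation_le[OF _ bound X q1(1)])
    also have "\<dots> \<le> 4 * q * X\<^sup>2 * (q * gcd \<bar>u1\<bar> (gcd u2 u3)) / \<bar>u1\<bar>"
    proof -
      have "?g dvd 2 * A1 * u1" "?g dvd 2 * A2 * u2" "?g dvd 2 * A3 * u3"
        by (simp_all only: gcd_dvd1 gcd_dvd2 dvd_trans[OF gcd_dvd2 gcd_dvd1] dvd_trans[OF gcd_dvd2 gcd_dvd2])
      then have "?g dvd (2 * A1 * u1) * (A2 * A3)" "?g dvd (2 * A2 * u2) * (A1 * A3)" "?g dvd (2 * A3 * u3) * (A1 * A2)"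
        by (simp_all only: dvd_mult2)
      moreover have "(2 * A1 * u1) * (A2 * A3) = q * u1" "(2 * A2 * u2) * (A1 * A3) = q * u2"
        "(2 * A3 * u3) * (A1 * A2) = q * u3" unfolding q_def by simp_all
      ultimately have "?g dvd q * u1" "?g dvd q * u2" "?g dvd q * u3" by (simp_all only:)
      then have "?g dvd gcd (q * u1) (gcd (q * u2) (q * u3))" by (intro gcd_greatest)
      also have "gcd (q * u1) (gcd (q * u2) (q * u3)) = q * gcd \<bar>u1\<bar> (gcd u2 u3)"
        using q1 by (simp add: gcd_mult_left abs_mult)
      finally have g: "?g \<le> q * gcd \<bar>u1\<bar> (gcd u2 u3)"
        by (rule zdvd_imp_le) (use q1 u in \<open>simp add: gcd_pos_int\<close>)
      have "\<bar>u1\<bar> * 1 \<le> \<bar>u1\<bar> * (2 * A1)" using A by (intro mult_left_mono) auto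
      then have "\<bar>u1\<bar> \<le> \<bar>2 * A1 * u1\<bar>" using A by (simp add: abs_mult mult.commute)
      then have le: "real_of_int \<bar>u1\<bar> \<le> real_of_int \<bar>2 * A1 * u1\<bar>" by linarith
      have c: "0 \<le> 4 * q * X\<^sup>2" using q1 by simp
      then have "4 * q * X\<^sup>2 * ?g \<le> 4 * q * X\<^sup>2 * (q * gcd \<bar>u1\<bar> (gcd u2 u3))"
        by (rule mult_left_mono[OF g])
      moreover have "0 \<le> 4 * q * X\<^sup>2 * (q * gcd \<bar>u1\<bar> (gcd u2 u3))"
        by (intro mult_nonneg_nonneg c) (use q1 in simp_all)
      moreover have "0 < \<bar>u1\<bar>" using u(1) by simp
      ultimately show ?thesis using le
        by (intro frac_le) (simp_all only: of_int_le_iff of_int_0_le_iff of_int_0_less_iff)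
    qed
    finally show "real (card (S (u1, u2, u3))) \<le> 4 * q\<^sup>2 * X\<^sup>2 * (gcd \<bar>u1\<bar> (gcd u2 u3) / \<bar>u1\<bar>)"
      by (simp add: power2_eq_square algebra_simps)
  qed
  also have "\<dots> = (\<Sum>u1\<in>U1. \<Sum>(u2, u3)\<in>R u1 \<times> R u1. 4 * q\<^sup>2 * X\<^sup>2 * (gcd \<bar>u1\<bar> (gcd u2 u3) / \<bar>u1\<bar>))"
    unfolding U_def by (subst sum.Sigma) (auto simp: U1_def R_def split_def)
  also have "\<dots> = (\<Sum>u1\<in>U1. 4 * q\<^sup>2 * X\<^sup>2 * ((\<Sum>u2\<in>R u1. \<Sum>u3\<in>R u1. real_of_int (gcd \<bar>u1\<bar> (gcd u2 u3))) / \<bar>u1\<bar>))"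
    by (simp add: sum.cartesian_product[symmetric] sum_distrib_left sum_divide_distrib)
  also have "\<dots> = 4 * q\<^sup>2 * X\<^sup>2 * (\<Sum>u1\<in>U1. (\<Sum>u2\<in>R u1. \<Sum>u3\<in>R u1. real_of_int (gcd \<bar>u1\<bar> (gcd u2 u3))) / \<bar>u1\<bar>)"
    (is "_ = _ * (\<Sum>u1\<in>U1. ?h u1)")
    by (simp add: sum_distrib_left)
  also have "(\<Sum>u1\<in>U1. ?h u1) = (\<Sum>u1\<in>{1..<X}. ?h u1) + (\<Sum>u1\<in>uminus ` {1..<X}. ?h u1)"
    unfolding U1_def by (rule sum.union_disjoint) auto
  also have "(\<Sum>u1\<in>uminus ` {1..<X}. ?h u1) = (\<Sum>u1\<in>{1..<X}. ?h u1)"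
    by (subst sum.reindex) (auto simp: R_def inj_on_def)
  also have "(\<Sum>u1\<in>{1..<X}. ?h u1)
      = (\<Sum>U\<in>{1..<X}. (\<Sum>v\<in>{-U..U}. \<Sum>w\<in>{-U..U}. real_of_int (gcd U (gcd v w))) / U)"
    by (rule sum.cong) (auto simp: R_def)
  also have "4 * q\<^sup>2 * X\<^sup>2 * (\<dots> + \<dots>) \<le> 4 * q\<^sup>2 * X\<^sup>2 * real_of_int (18 * X\<^sup>2 + 18 * X\<^sup>2)"
    using gcd_sum_total_le[OF X] by (intro mult_left_mono) auto
  finally show ?thesis by (simp add: power2_eq_square power4_eq_xxxx)
qed

text \<open>A box of X^3 points has at most X^3 diagonal pairs and 3 * 144 * q^2 * X^4 other
  collisions. The image thus has order at least X^6 / X^4 = X^2, which is also the order of the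
  largest values.\<close>

lemma card_three_quadratics_image_ge:
  fixes A1 A2 A3 B1 B2 B3 X :: int
  assumes A: "A1 > 0" "A2 > 0" "A3 > 0" and X: "X \<ge> 1"
  defines "F \<equiv> (\<lambda>(x1, x2, x3). (A1 * x1\<^sup>2 + B1 * x1) + (A2 * x2\<^sup>2 + B2 * x2) + (A3 * x3\<^sup>2 + B3 * x3))"
  shows "real_of_int X ^ 2 \<le> card (F ` ({0..<X} \<times> {0..<X} \<times> {0..<X})) * (1 + 432 * (2 * A1 * A2 * A3)\<^sup>2)"
proof -
  define T where "T = {0..<X} \<times> {0..<X} \<times> {0..<X}"
  define q where "q = 2 * A1 * A2 * A3"
  let ?f1 = "\<lambda>x. A1 * x\<^sup>2 + B1 * x" and ?f2 = "\<lambda>x. A2 * x\<^sup>2 + B2 * x" and ?f3 = "\<lambda>x. A3 * x\<^sup>2 + B3 * x"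
  define Z1 where "Z1 = dominant_collisions ?f1 ?f2 ?f3 X"
  define Z2 where "Z2 = dominant_collisions ?f2 ?f1 ?f3 X"
  define Z3 where "Z3 = dominant_collisions ?f3 ?f1 ?f2 X"
  let ?p2 = "\<lambda>((x1, x2, x3), (y1, y2, y3)). ((x2, x1, x3 :: int), (y2, y1, y3 :: int))"
  let ?p3 = "\<lambda>((x1, x2, x3), (y1, y2, y3)). ((x2, x3, x1 :: int), (y2, y3, y1 :: int))"
  let ?C = "{(x, y) \<in> T \<times> T. F x = F y}"
  have fin: "finite Z1" "finite Z2" "finite Z3" "finite T"
    unfolding Z1_def Z2_def Z3_def T_def by (simp_all add: finite_dominant_collisions)
  have "?C \<subseteq> (\<lambda>x. (x, x)) ` T \<union> Z1 \<union> ?p2 ` Z2 \<union> ?p3 ` Z3"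
  proof
    fix z assume "z \<in> ?C"
    moreover obtain x1 x2 x3 y1 y2 y3 where z: "z = ((x1, x2, x3), (y1, y2, y3))" by (metis surj_pair)
    ultimately have box: "{x1, x2, x3, y1, y2, y3} \<subseteq> {0..<X}"
      and eq: "?f1 x1 + ?f2 x2 + ?f3 x3 = ?f1 y1 + ?f2 y2 + ?f3 y3"
      unfolding T_def F_def by simp_all
    have max: "p = 0 \<and> q = 0 \<and> r = 0 \<or> p \<noteq> 0 \<and> q \<le> p \<and> r \<le> p
        \<or> q \<noteq> 0 \<and> p \<le> q \<and> r \<le> q \<or> r \<noteq> 0 \<and> p \<le> r \<and> q \<le> r" if "p \<ge> 0" "q \<ge> 0" "r \<ge> 0" for p q r :: int
      using that by linarith
    consider "x1 = y1" "x2 = y2" "x3 = y3"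
      | "x1 \<noteq> y1" "\<bar>x2 - y2\<bar> \<le> \<bar>x1 - y1\<bar>" "\<bar>x3 - y3\<bar> \<le> \<bar>x1 - y1\<bar>"
      | "x2 \<noteq> y2" "\<bar>x1 - y1\<bar> \<le> \<bar>x2 - y2\<bar>" "\<bar>x3 - y3\<bar> \<le> \<bar>x2 - y2\<bar>"
      | "x3 \<noteq> y3" "\<bar>x1 - y1\<bar> \<le> \<bar>x3 - y3\<bar>" "\<bar>x2 - y2\<bar> \<le> \<bar>x3 - y3\<bar>"
      using max[of "\<bar>x1 - y1\<bar>" "\<bar>x2 - y2\<bar>" "\<bar>x3 - y3\<bar>"] by auto
    then show "z \<in> (\<lambda>x. (x, x)) ` T \<union> Z1 \<union> ?p2 ` Z2 \<union> ?p3 ` Z3"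
    proof cases
      case 1
      then show ?thesis unfolding z T_def using box by auto
    next
      case 2
      then have "z \<in> Z1" unfolding z Z1_def dominant_collisions_def using box eq by simp
      then show ?thesis by blast
    next
      case 3
      then have "((x2, x1, x3), (y2, y1, y3)) \<in> Z2" unfolding Z2_def dominant_collisions_def using box eq by simp
      then have "z \<in> ?p2 ` Z2" unfolding z by (rule rev_image_eqI) simp
      then show ?thesis by blast
    next
      case 4
      then have "((x3, x1, x2), (y3, y1, y2)) \<in> Z3" unfolding Z3_def dominant_collisions_def using box eq by simp
      then have "z \<in> ?p3 ` Z3" unfolding z by (rule rev_image_eqI) simp
      then show ?thesis by blast
    qed
  qed
  then have "card ?C \<le> card ((\<lambda>x. (x, x)) ` T \<union> Z1 \<union> ?p2 ` Z2 \<union> ?p3 ` Z3)"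
    using fin by (intro card_mono) auto
  also have "\<dots> \<le> card ((\<lambda>x. (x, x)) ` T) + card Z1 + card (?p2 ` Z2) + card (?p3 ` Z3)"
    by (meson card_Un_le add_mono order_refl order_trans)
  also have "\<dots> \<le> card T + card Z1 + card Z2 + card Z3"
    using fin by (intro add_mono card_image_le) auto
  finally have "real (card ?C) \<le> card T + real (card Z1) + card Z2 + card Z3" by linarith
  also have "\<dots> \<le> X ^ 3 + 144 * q\<^sup>2 * X ^ 4 + 144 * q\<^sup>2 * X ^ 4 + 144 * q\<^sup>2 * X ^ 4"
  proof -
    have T3: "real (card T) = X ^ 3" unfolding T_def using X by (simp add: power3_eq_cube)
    have "real (card Z1) \<le> 144 * q\<^sup>2 * X ^ 4" "real (card Z2) \<le> 144 * q\<^sup>2 * X ^ 4" "real (card Z3) \<le> 144 * q\<^sup>2 * X ^ 4"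
      unfolding Z1_def Z2_def Z3_def q_def
      using card_dominant_collisions_le[of A1 A2 A3 X B1 B2 B3] card_dominant_collisions_le[of A2 A1 A3 X B2 B1 B3]
        card_dominant_collisions_le[of A3 A1 A2 X B3 B1 B2] A X by (simp_all add: mult.commute mult.left_commute)
    then show ?thesis unfolding T3 by simp
  qed
  also have "\<dots> \<le> real_of_int X ^ 4 * (1 + 432 * q\<^sup>2)"
  proof -
    have "real_of_int X ^ 3 \<le> real_of_int X ^ 4" using X by (intro power_increasing) auto
    then show ?thesis by (simp add: algebra_simps)
  qed
  finally have C: "real (card ?C) \<le> real_of_int X ^ 4 * (1 + 432 * q\<^sup>2)" .
  have "(real (card T))\<^sup>2 \<le> card (F ` T) * real (card ?C)"
    using card_square_le_card_image_collisions[OF fin(4), of F] by (simp flip: of_nat_mult of_nat_power)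
  also have "\<dots> \<le> card (F ` T) * (real_of_int X ^ 4 * (1 + 432 * q\<^sup>2))" using C by (intro mult_left_mono) auto
  finally have "real_of_int X ^ 4 * real_of_int X ^ 2 \<le> real_of_int X ^ 4 * (card (F ` T) * (1 + 432 * q\<^sup>2))"
    unfolding T_def using X by (simp add: power2_eq_square power4_eq_xxxx algebra_simps)
  then have "real_of_int X ^ 2 \<le> card (F ` T) * (1 + 432 * q\<^sup>2)"
    using X by (simp only: mult_le_cancel_left_pos zero_less_power of_int_0_less_iff)
  then show ?thesis unfolding T_def q_def by simp
qed

text \<open>Doubling turns every term into A * x^2 + B * x with integers A and B. On a box of side
  about sqrt (N / Q) the doubled values are at most N, and a fixed proportion of N many are
  distinct.\<close>

lemma reps_three_positive_density:
  assumes "card J = 3" and am: "\<And>j. j \<in> J \<Longrightarrow> a j \<ge> 1 \<and> m j \<ge> 3"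
  shows "\<exists>\<delta>>0. \<forall>N\<ge>1. \<delta> * real_of_int N \<le> card (reps a m J \<inter> {0..<N})"
proof -
  obtain i j l where J: "J = {i, j, l}" "i \<noteq> j" "i \<noteq> l" "j \<noteq> l"
    using assms(1) by (auto simp: card_3_iff)
  define A where "A k = int (a k) * (int (m k) - 2)" for k
  define B where "B k = - int (a k) * (int (m k) - 4)" for k
  have A: "A i > 0" "A j > 0" "A l > 0" using am J unfolding A_def by force+
  define F where "F = (\<lambda>(x1, x2, x3). (A i * x1\<^sup>2 + B i * x1) + (A j * x2\<^sup>2 + B j * x2) + (A l * x3\<^sup>2 + B l * x3))"
  define Q where "Q = A i + A j + A l + \<bar>B i\<bar> + \<bar>B j\<bar> + \<bar>B l\<bar>"
  define c where "c = 1 + 432 * (2 * A i * A j * A l)\<^sup>2"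
  have Q: "Q \<ge> 1" unfolding Q_def using A by linarith
  have c: "c \<ge> 1" unfolding c_def by simp
  \<comment> \<open>Rounding sqrt (N / Q) >= 1 down to X loses at most a factor 2, hence the 4. For
    N < Q the element 0 alone suffices.\<close>
  define \<delta> where "\<delta> = 1 / (4 * real_of_int Q * c)"
  have t: "2 * (int (a k) * polygonal (m k) y) = A k * y\<^sup>2 + B k * y" for k y
    using two_times_polygonal[of "m k" y] unfolding A_def B_def
    by (simp add: mult.left_commute[of 2]) (simp add: algebra_simps)
  have rep: "\<exists>n \<in> reps a m J. F (x1, x2, x3) = 2 * n" for x1 x2 x3
  proof -
    define x where "x k = (if k = i then x1 else if k = j then x2 else x3)" for k
    have "F (x1, x2, x3) = 2 * (\<Sum>k\<in>J. int (a k) * polygonal (m k) (x k))"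
      using J(2-) unfolding J(1) F_def by (simp add: distrib_left t x_def)
    then show ?thesis by (blast intro: repsI)
  qed
  have "\<delta> * real_of_int N \<le> card (reps a m J \<inter> {0..<N})" if N: "N \<ge> 1" for N
  proof (cases "N \<ge> Q")
    case False
    have "{0} \<subseteq> reps a m J \<inter> {0..<N}" using N zero_in_reps by auto
    then have "card {0::int} \<le> card (reps a m J \<inter> {0..<N})" by (intro card_mono) auto
    moreover have "\<delta> * real_of_int N \<le> 1"
    proof -
      have "real_of_int N \<le> 4 * real_of_int Q * 1" using False Q by simp
      also have "\<dots> \<le> 4 * real_of_int Q * c" using c Q by (intro mult_left_mono) auto
      finally show ?thesis unfolding \<delta>_def using Q c by (simp add: divide_le_eq)
    qed
    ultimately show ?thesis by simp
  next
    case True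
    define X where "X = \<lfloor>sqrt (N / Q)\<rfloor>"
    have NQ: "real_of_int N / Q \<ge> 1" using True Q by simp
    then have X1: "X \<ge> 1" unfolding X_def by simp
    have "(real_of_int X)\<^sup>2 \<le> (sqrt (N / Q))\<^sup>2" using X1 unfolding X_def by (intro power_mono) auto
    then have Xle: "real_of_int X ^ 2 \<le> N / Q" using NQ by simp
    have "sqrt (N / Q) \<le> 2 * real_of_int X" using X1 unfolding X_def by linarith
    then have "(sqrt (N / Q))\<^sup>2 \<le> (2 * real_of_int X)\<^sup>2" using NQ by (intro power_mono) auto
    then have Xge: "N / Q \<le> 4 * real_of_int X ^ 2" using NQ by (simp add: power_mult_distrib)
    have "real_of_int (Q * X\<^sup>2) \<le> N" using Xle Q by (simp add: field_simps)
    then have QX: "Q * X\<^sup>2 \<le> N" by linarith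
    let ?T = "{0..<X} \<times> {0..<X} \<times> {0..<X}"
    have sub: "F ` ?T \<subseteq> (\<lambda>n. 2 * n) ` (reps a m J \<inter> {0..<N})"
    proof
      fix y assume "y \<in> F ` ?T"
      then obtain x1 x2 x3 where y: "y = F (x1, x2, x3)" "x1 \<in> {0..<X}" "x2 \<in> {0..<X}" "x3 \<in> {0..<X}" by auto
      obtain n where n: "n \<in> reps a m J" "y = 2 * n" using rep y by blast
      have b: "A k * x\<^sup>2 + B k * x \<le> (A k + \<bar>B k\<bar>) * X\<^sup>2" if "x \<in> {0..<X}" "A k > 0" for k x
      proof -
        have "x \<le> x\<^sup>2" using that by (cases "x = 0") (simp_all add: power2_eq_square)
        moreover have x2: "x\<^sup>2 \<le> X\<^sup>2" using that by (intro power_mono) auto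
        ultimately have xX: "x \<le> X\<^sup>2" by linarith
        have "B k * x \<le> \<bar>B k\<bar> * x" using that by (intro mult_right_mono) auto
        also have "\<dots> \<le> \<bar>B k\<bar> * X\<^sup>2" using xX by (intro mult_left_mono) auto
        finally have "B k * x \<le> \<bar>B k\<bar> * X\<^sup>2" .
        moreover have "A k * x\<^sup>2 \<le> A k * X\<^sup>2" using x2 that by (intro mult_left_mono) auto
        ultimately show ?thesis by (simp add: algebra_simps)
      qed
      have "y \<le> Q * X\<^sup>2" using b[OF y(2) A(1)] b[OF y(3) A(2)] b[OF y(4) A(3)]
        unfolding y F_def Q_def by (simp add: algebra_simps)
      then have "2 * n \<le> N" using n QX by simp
      moreover have "n \<ge> 0" using n reps_nonneg[of J m a] am by auto
      ultimately have "n \<in> {0..<N}" using N by auto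
      then show "y \<in> (\<lambda>n. 2 * n) ` (reps a m J \<inter> {0..<N})" using n by auto
    qed
    have "card (F ` ?T) \<le> card ((\<lambda>n. 2 * n) ` (reps a m J \<inter> {0..<N}))" by (rule card_mono[OF _ sub]) simp
    also have "\<dots> \<le> card (reps a m J \<inter> {0..<N})" by (rule card_image_le) simp
    finally have "real (card (F ` ?T)) \<le> card (reps a m J \<inter> {0..<N})" by simp
    moreover have "real_of_int X ^ 2 \<le> card (F ` ?T) * c"
      using card_three_quadratics_image_ge[OF A X1, of "B i" "B j" "B l"] unfolding F_def c_def by simp
    moreover have "real (card (F ` ?T)) * real_of_int c \<le> card (reps a m J \<inter> {0..<N}) * real_of_int c"
      using c calculation(1) by (intro mult_right_mono) simp_all
    ultimately have "real_of_int X ^ 2 \<le> card (reps a m J \<inter> {0..<N}) * real_of_int c"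
      unfolding of_int_mult of_int_of_nat_eq by linarith
    then have "N / Q \<le> 4 * (card (reps a m J \<inter> {0..<N}) * real_of_int c)" using Xge by linarith
    then show ?thesis unfolding \<delta>_def using Q c by (simp add: field_simps)
  qed
  moreover have "\<delta> > 0" unfolding \<delta>_def using Q c by simp
  ultimately show ?thesis by blast
qed

section \<open>Unit squares and diagonal forms modulo prime powers\<close>

section \<open>Local representation\<close>

text \<open>This takes the place of Hensel's iteration: the factor 1 + p^c * (x + y) of a difference
  of values is prime to p, so the map is injective on residues and therefore surjective.\<close>

lemma quadratic_surjective_mod_prime_power:
  fixes p z :: int
  assumes p: "prime p" and c: "c \<ge> 1"
  shows "\<exists>y. p ^ f dvd y + p ^ c * y\<^sup>2 - z"
proof -
  define q where "q = p ^ f"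
  have q: "q > 0" unfolding q_def using p prime_gt_0_int by simp
  let ?g = "\<lambda>y. (y + p ^ c * y\<^sup>2) mod q"
  have "inj_on ?g {0..<q}"
  proof (rule inj_onI)
    fix x y assume xy: "x \<in> {0..<q}" "y \<in> {0..<q}" "?g x = ?g y"
    then have "q dvd (x + p ^ c * x\<^sup>2) - (y + p ^ c * y\<^sup>2)" by (simp only: mod_eq_dvd_iff)
    also have "(x + p ^ c * x\<^sup>2) - (y + p ^ c * y\<^sup>2) = (1 + p ^ c * (x + y)) * (x - y)"
      by (simp add: algebra_simps power2_eq_square)
    finally have d: "q dvd (1 + p ^ c * (x + y)) * (x - y)" .
    have "\<not> p dvd 1 + p ^ c * (x + y)"
    proof
      assume "p dvd 1 + p ^ c * (x + y)"
      moreover have "p dvd p ^ c * (x + y)" using c by (simp add: dvd_power)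
      ultimately have "p dvd 1" by (simp only: dvd_add_left_iff)
      then show False using p by (simp add: not_prime_unit)
    qed
    then have "coprime q (1 + p ^ c * (x + y))" unfolding q_def using p
      by (meson coprime_power_left_iff prime_imp_coprime)
    then have "q dvd x - y" using d by (simp add: coprime_dvd_mult_right_iff)
    then have "x mod q = y mod q" by (simp add: mod_eq_dvd_iff)
    then show "x = y" using xy(1,2) by simp
  qed
  then have "card (?g ` {0..<q}) = card {0..<q}" by (rule card_image)
  moreover have "?g ` {0..<q} \<subseteq> {0..<q}" using q by auto
  ultimately have "?g ` {0..<q} = {0..<q}" by (intro card_subset_eq) simp_all
  moreover have "z mod q \<in> {0..<q}" using q by simp
  ultimately have "z mod q \<in> ?g ` {0..<q}" by (simp only:)
  then obtain y where "?g y = z mod q" by (auto simp only: image_iff)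
  then show ?thesis unfolding q_def by (simp only: mod_eq_dvd_iff) blast
qed

text \<open>The square of s = 1 + 2 * p^c * y is 1 + 4 * p^c * (y + p^c * y^2). The factor 4 allows
  p = 2 to be treated together with the odd primes.\<close>

lemma square_near_one_mod_prime_power:
  fixes p z :: int
  assumes "prime p" "c \<ge> 1"
  shows "\<exists>s. p ^ c dvd s - 1 \<and> p ^ f dvd s\<^sup>2 - (1 + 4 * p ^ c * z)"
proof -
  obtain y where y: "p ^ f dvd y + p ^ c * y\<^sup>2 - z"
    using quadratic_surjective_mod_prime_power[OF assms] by blast
  have "(1 + 2 * p ^ c * y)\<^sup>2 - (1 + 4 * p ^ c * z) = 4 * p ^ c * (y + p ^ c * y\<^sup>2 - z)"
    by (simp add: algebra_simps power2_eq_square)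
  then have "p ^ f dvd (1 + 2 * p ^ c * y)\<^sup>2 - (1 + 4 * p ^ c * z)" using y by simp
  then show ?thesis by (intro exI[of _ "1 + 2 * p ^ c * y"]) simp
qed

lemma unit_inverse_mod_prime_power:
  fixes p u z :: int
  assumes "prime p" "\<not> p dvd u"
  shows "\<exists>y. p ^ f dvd u * y - z"
proof -
  have "coprime u (p ^ f)" using assms by (metis coprime_commute coprime_power_right_iff prime_imp_coprime)
  then obtain i where "[u * i = 1] (mod p ^ f)" using cong_solve_coprime_int by blast
  then have "p ^ f dvd u * i - 1" by (simp add: cong_iff_dvd_diff)
  then have "p ^ f dvd (u * i - 1) * z" by simp
  then show ?thesis by (intro exI[of _ "i * z"]) (simp add: algebra_simps)
qed

lemma odd_prime_not_dvd_four:
  fixes p :: int assumes "prime p" "p \<noteq> 2" shows "\<not> p dvd 4"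
proof
  assume "p dvd 4"
  moreover have "(4::int) = 2 * 2" by simp
  ultimately have "p dvd 2 * 2" by (simp only:)
  then have "p dvd 2" using prime_dvd_mult_iff[OF assms(1), of 2 2] by blast
  then have "p \<le> 2" by (rule zdvd_imp_le) simp
  then show False using prime_ge_2_int[OF assms(1)] assms(2) by linarith
qed

text \<open>An invariant of p-adic units modulo squares: odd squares are 1 modulo 8, and for odd p
  the quadratic character decides. Both kinds of values lie in one range of nine integers, which
  enters the pigeonhole count.\<close>

definition square_class :: "int \<Rightarrow> int \<Rightarrow> int" where
  "square_class p u = (if p = 2 then u mod 8 else Legendre u p)"

lemma square_class_range: "square_class p u \<in> {-1..7}"
proof -
  have "0 \<le> u mod 8" "u mod 8 < 8" by simp_all
  moreover have "Legendre u p \<in> {-1, 0, 1}" by (simp add: Legendre_def)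
  ultimately show ?thesis unfolding square_class_def by auto
qed

text \<open>The approximate root q0 is multiplied by s with s^2 = 1 + 4 * p * z, where z solves u *
  q0^2 * 4 * p * z = u' - u * q0^2. For p = 2 the factor 4 * p is the given divisor 8; for odd p the
  factor 4 is a unit.\<close>

lemma unit_square_multiple_mod_prime_power:
  fixes p u u' :: int
  assumes p: "prime p" and u: "\<not> p dvd u" and d: "p dvd u' - u * q0\<^sup>2" "p = 2 \<Longrightarrow> 8 dvd u' - u * q0\<^sup>2"
    and q0: "\<not> p dvd q0"
  shows "\<exists>q. p ^ f dvd u * q\<^sup>2 - u'"
proof -
  have u0: "\<not> p dvd u * q0\<^sup>2" using u q0 p by (simp add: prime_dvd_mult_iff prime_dvd_power_iff)
  have "\<exists>z. p ^ f dvd u * q0\<^sup>2 * (4 * p * z) - (u' - u * q0\<^sup>2)"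
  proof (cases "p = 2")
    case True
    then obtain t where t: "u' - u * q0\<^sup>2 = 8 * t" using d by (auto elim: dvdE)
    obtain z where "p ^ f dvd u * q0\<^sup>2 * z - t" using unit_inverse_mod_prime_power[OF p u0] by blast
    then have "p ^ f dvd 8 * (u * q0\<^sup>2 * z - t)" by (rule dvd_mult)
    then show ?thesis unfolding t True by (intro exI[of _ z]) (simp add: algebra_simps)
  next
    case False
    obtain t where t: "u' - u * q0\<^sup>2 = p * t" using d(1) by (auto elim: dvdE)
    have "\<not> p dvd 4" using p False by (rule odd_prime_not_dvd_four)
    then have "\<not> p dvd 4 * (u * q0\<^sup>2)" using u0 p by (metis prime_dvd_mult_iff)
    then obtain z where "p ^ f dvd 4 * (u * q0\<^sup>2) * z - t" using unit_inverse_mod_prime_power[OF p] by blast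
    then have "p ^ f dvd p * (4 * (u * q0\<^sup>2) * z - t)" by (rule dvd_mult)
    then show ?thesis unfolding t by (intro exI[of _ z]) (simp add: algebra_simps)
  qed
  then obtain z where z: "p ^ f dvd u * q0\<^sup>2 * (4 * p * z) - (u' - u * q0\<^sup>2)" by blast
  obtain s where s: "p ^ f dvd s\<^sup>2 - (1 + 4 * p ^ 1 * z)" using square_near_one_mod_prime_power[OF p, of 1] by blast
  have eq: "u * (q0 * s)\<^sup>2 - u' = u * q0\<^sup>2 * (s\<^sup>2 - (1 + 4 * p ^ 1 * z)) + (u * q0\<^sup>2 * (4 * p * z) - (u' - u * q0\<^sup>2))"
    by (simp add: algebra_simps power_mult_distrib)
  have "p ^ f dvd u * (q0 * s)\<^sup>2 - u'" unfolding eq by (intro dvd_add dvd_mult s z)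
  then show ?thesis by blast
qed

lemma same_square_class_imp_square_multiple:
  fixes p u u' :: int
  assumes p: "prime p" and u: "\<not> p dvd u" and u': "\<not> p dvd u'" and eq: "square_class p u = square_class p u'"
  shows "\<exists>q. p ^ f dvd u * q\<^sup>2 - u'"
proof (cases "p = 2")
  case True
  then have "u' mod 8 = u mod 8" using eq by (simp add: square_class_def)
  then have "8 dvd u' - u" by (simp add: mod_eq_dvd_iff)
  then show ?thesis using unit_square_multiple_mod_prime_power[OF p u, of u' 1 f] True p dvd_trans[of 2 8 "u' - u"] by simp
next
  case False
  obtain n where n: "p = int n" using p prime_ge_0_int nonneg_int_cases by metis
  have pn: "prime n" using p n by simp
  then have n2: "2 < n" using False n prime_ge_2_nat[of n] by (cases "n = 2") auto
  have L: "Legendre u p = Legendre u' p" using eq False by (simp add: square_class_def)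
  have E: "[Legendre b p = b ^ ((n - 1) div 2)] (mod p)" for b
    unfolding n by (rule euler_criterion[OF pn n2])
  have "\<not> [u = 0] (mod p)" using u by (simp add: cong_0_iff)
  then have "Legendre u p * Legendre u' p = 1" unfolding L[symmetric] by (simp add: Legendre_def)
  \<comment> \<open>Euler's criterion makes the symbol multiplicative modulo p. Its values lie in
    {-1, 0, 1} and p > 2, so the congruence with 1 becomes an equality.\<close>
  moreover have "[Legendre (u * u') p = Legendre u p * Legendre u' p] (mod p)"
    using cong_trans[OF E[of "u * u'", unfolded power_mult_distrib] cong_sym[OF cong_mult[OF E E]]] .
  ultimately have "[Legendre (u * u') p = 1] (mod p)" by simp
  then have "p dvd Legendre (u * u') p - 1" by (simp add: cong_iff_dvd_diff)
  moreover have "\<not> p dvd -1 - 1" "\<not> p dvd 0 - 1" using n2 n by (auto dest!: zdvd_imp_le)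
  moreover have "Legendre (u * u') p = -1 \<or> Legendre (u * u') p = 0 \<or> Legendre (u * u') p = 1"
    by (simp add: Legendre_def)
  ultimately have "Legendre (u * u') p = 1" by auto
  then have "QuadRes p (u * u')" by (simp add: Legendre_def split: if_splits)
  then obtain x where "[x\<^sup>2 = u * u'] (mod p)" unfolding QuadRes_def by blast
  then have x: "p dvd x\<^sup>2 - u * u'" by (simp add: cong_iff_dvd_diff)
  obtain i where "p ^ 1 dvd u * i - 1" using unit_inverse_mod_prime_power[OF p u] by blast
  then have i: "p dvd u * i - 1" by simp
  \<comment> \<open>Modulo p, x * i is the quotient x / u, and u * (x / u)^2 = u' since x^2 = u *
    u'.\<close>
  have eq: "u' - u * (x * i)\<^sup>2 = - ((x\<^sup>2 - u * u') * (u * i\<^sup>2) + (u * i - 1) * (u' * (u * i + 1)))"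
    by (simp add: algebra_simps power2_eq_square)
  have d: "p dvd u' - u * (x * i)\<^sup>2" unfolding eq dvd_minus_iff by (intro dvd_add dvd_mult2 x i)
  have "\<not> p dvd x * i"
  proof
    assume "p dvd x * i"
    then have "p dvd u * (x * i)\<^sup>2" by (simp add: power2_eq_square)
    then show False using d u' by (simp add: dvd_diff_left_iff)
  qed
  then show ?thesis using unit_square_multiple_mod_prime_power[OF p u d _ \<open>\<not> p dvd x * i\<close>] False by simp
qed

text \<open>All four unit parts equal \<open>u i0\<close> up to squares, and the even gaps K - v i
  are filled by squares of powers of p. The form becomes p^K * u i0 times a sum of four squares, and
  Lagrange's theorem applies to a nonnegative residue of n / u i0.\<close>

lemma four_same_class_represent:
  fixes p n :: int and u :: "nat \<Rightarrow> int" and v :: "nat \<Rightarrow> nat"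
  assumes p: "prime p" and X: "card X = 4" "i0 \<in> X"
    and u: "\<And>i. i \<in> X \<Longrightarrow> \<not> p dvd u i" "\<And>i. i \<in> X \<Longrightarrow> square_class p (u i) = square_class p (u i0)"
    and v: "\<And>i. i \<in> X \<Longrightarrow> v i \<le> K" "\<And>i. i \<in> X \<Longrightarrow> even (K - v i)"
  shows "\<exists>y. p ^ f dvd (\<Sum>i\<in>X. p ^ v i * u i * (y i)\<^sup>2) - p ^ K * n"
proof -
  have "\<exists>q. p ^ f dvd u i * q\<^sup>2 - u i0" if "i \<in> X" for i
    using same_square_class_imp_square_multiple[OF p u(1)[OF that] u(1)[OF X(2)] u(2)[OF that]] .
  then obtain q where q: "\<And>i. i \<in> X \<Longrightarrow> p ^ f dvd u i * (q i)\<^sup>2 - u i0" by metis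
  obtain t where t: "p ^ f dvd u i0 * t - n" using unit_inverse_mod_prime_power[OF p u(1)[OF X(2)]] by blast
  define N where "N = t mod p ^ f"
  have "p ^ f > 0" using p prime_gt_0_int by simp
  then have "N \<ge> 0" unfolding N_def by simp
  then obtain b1 b2 b3 b4 where b: "N = b1\<^sup>2 + b2\<^sup>2 + b3\<^sup>2 + b4\<^sup>2"
    using four_squares_nonneg unfolding four_squares_def by blast
  have "card (X - {i0}) = 3" using X by (simp add: card_Diff_singleton)
  then obtain i1 i2 i3 where i: "X - {i0} = {i1, i2, i3}" "i1 \<noteq> i2" "i1 \<noteq> i3" "i2 \<noteq> i3"
    by (auto simp: card_3_iff)
  have ne: "i1 \<noteq> i0" "i2 \<noteq> i0" "i3 \<noteq> i0" using i(1) by blast+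
  have X4: "X = {i0, i1, i2, i3}" using i(1) X(2) by blast
  define r where "r k = (if k = i0 then b1 else if k = i1 then b2 else if k = i2 then b3 else b4)" for k
  have r: "N = (\<Sum>i\<in>X. (r i)\<^sup>2)" unfolding X4 b r_def using i(2-) ne by simp
  define y where "y i = p ^ ((K - v i) div 2) * q i * r i" for i
  have y: "p ^ v i * u i * (y i)\<^sup>2 = p ^ K * (u i * (q i)\<^sup>2 * (r i)\<^sup>2)" if "i \<in> X" for i
  proof -
    have "p ^ v i * (p ^ ((K - v i) div 2))\<^sup>2 = p ^ (v i + ((K - v i) div 2) * 2)"
      by (simp add: power_add power_mult)
    also have "v i + ((K - v i) div 2) * 2 = K" using v[OF that] by simp
    finally have "p ^ v i * (p ^ ((K - v i) div 2))\<^sup>2 = p ^ K" .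
    moreover have "p ^ v i * u i * (y i)\<^sup>2
        = (p ^ v i * (p ^ ((K - v i) div 2))\<^sup>2) * (u i * (q i)\<^sup>2 * (r i)\<^sup>2)"
      unfolding y_def power_mult_distrib by (simp only: mult_ac)
    ultimately show ?thesis by simp
  qed
  have "(\<Sum>i\<in>X. p ^ v i * u i * (y i)\<^sup>2) - p ^ K * n
    = (\<Sum>i\<in>X. p ^ K * (u i * (q i)\<^sup>2 * (r i)\<^sup>2)) - p ^ K * n" by (simp only: y cong: sum.cong)
  also have "\<dots> = (\<Sum>i\<in>X. p ^ K * ((u i * (q i)\<^sup>2 - u i0) * (r i)\<^sup>2) + p ^ K * u i0 * (r i)\<^sup>2) - p ^ K * n"
    by (intro arg_cong2[where f = "(-)"] sum.cong refl) (simp add: algebra_simps)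
  also have "\<dots> = (\<Sum>i\<in>X. p ^ K * ((u i * (q i)\<^sup>2 - u i0) * (r i)\<^sup>2)) + p ^ K * (u i0 * N - n)"
  proof -
    have "(\<Sum>i\<in>X. p ^ K * u i0 * (r i)\<^sup>2) = p ^ K * u i0 * N" unfolding r by (simp add: sum_distrib_left)
    then show ?thesis unfolding sum.distrib by (simp add: algebra_simps)
  qed
  finally have eq: "(\<Sum>i\<in>X. p ^ v i * u i * (y i)\<^sup>2) - p ^ K * n
    = (\<Sum>i\<in>X. p ^ K * ((u i * (q i)\<^sup>2 - u i0) * (r i)\<^sup>2)) + p ^ K * (u i0 * N - n)" .
  have "p ^ f dvd t - N" unfolding N_def by (metis dvd_triv_left minus_mod_eq_mult_div)
  then have "p ^ f dvd (u i0 * t - n) - u i0 * (t - N)" by (rule dvd_diff[OF t dvd_mult])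
  then have "p ^ f dvd u i0 * N - n" by (simp add: algebra_simps)
  then have "p ^ f dvd (\<Sum>i\<in>X. p ^ v i * u i * (y i)\<^sup>2) - p ^ K * n"
    unfolding eq using q by (intro dvd_add dvd_sum dvd_mult dvd_mult2) auto
  then show ?thesis by blast
qed

text \<open>55 = 3 * 18 + 1, and 18 = 2 * 9 counts the pairs of a parity of the valuation and a
  square class.\<close>

lemma exists_four_same_key:
  assumes "finite C" "card C \<ge> 55" "key ` C \<subseteq> S" "finite S" "card S \<le> 18"
  shows "\<exists>X k. X \<subseteq> C \<and> card X = 4 \<and> (\<forall>i\<in>X. key i = k)"
proof -
  have "\<exists>k\<in>S. card {i \<in> C. key i = k} \<ge> 4"
  proof (rule ccontr)
    assume no: "\<not> ?thesis"
    have le: "card {i \<in> C. key i = k} \<le> 3" if "k \<in> S" for k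
    proof -
      have "\<not> card {i \<in> C. key i = k} \<ge> 4" using no that by blast
      then show ?thesis by linarith
    qed
    have "C = (\<Union>k\<in>S. {i \<in> C. key i = k})" using assms(3) by (auto simp: image_subset_iff)
    then have "card C = card (\<Union>k\<in>S. {i \<in> C. key i = k})" by (rule arg_cong)
    also have "\<dots> \<le> (\<Sum>k\<in>S. card {i \<in> C. key i = k})" by (rule card_UN_le[OF assms(4)])
    also have "\<dots> \<le> (\<Sum>k\<in>S. 3)" using le by (intro sum_mono)
    also have "\<dots> = card S * 3" by simp
    also have "\<dots> \<le> 54" using assms(5) by linarith
    finally show False using assms(2) by simp
  qed
  then obtain k where "4 \<le> card {i \<in> C. key i = k}" by blast
  then obtain X where X: "X \<subseteq> {i \<in> C. key i = k}" "card X = 4"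
    by (rule obtain_subset_with_card_n)
  then have "X \<subseteq> C" "\<forall>i\<in>X. key i = k" by auto
  with X(2) show ?thesis by (intro exI conjI)
qed

text \<open>The number W depends neither on p nor on f, so that prime powers can later be glued. The
  w i will come from completing squares and must keep their residues modulo M. The exponent 6 is a
  convenient surplus: p^(K + t) divides W, and the sixth power covers the valuations met in both
  cases below.\<close>

lemma diagonal_form_closed_mod_prime_power:
  fixes a w :: "nat \<Rightarrow> int" and p M z :: int
  assumes C: "finite C" "card C \<ge> 55" and a: "\<And>i. i \<in> C \<Longrightarrow> a i > 0"
    and p: "prime p" and M: "M > 0"
  defines "W \<equiv> (\<Prod>i\<in>C. a i) * M"
  shows "\<exists>w'. (\<forall>i\<in>C. p ^ multiplicity p M dvd w' i - w i) \<and>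
     p ^ f dvd (\<Sum>i\<in>C. a i * (w' i)\<^sup>2) - (\<Sum>i\<in>C. a i * (w i)\<^sup>2) - W ^ 6 * z"
proof -
  have nu: "\<not> is_unit p" using p not_prime_unit by blast
  have "\<exists>u. a i = p ^ multiplicity p (a i) * u \<and> \<not> p dvd u" if "i \<in> C" for i
    using multiplicity_decompose'[of "a i" p] a[OF that] nu by (metis less_irrefl)
  then obtain u where u: "\<And>i. i \<in> C \<Longrightarrow> a i = p ^ multiplicity p (a i) * u i \<and> \<not> p dvd u i" by metis
  define v where "v i = multiplicity p (a i)" for i
  define key where "key i = (v i mod 2, square_class p (u i))" for i
  have "\<exists>X k. X \<subseteq> C \<and> card X = 4 \<and> (\<forall>i\<in>X. key i = k)"
    by (rule exists_four_same_key[OF C, of _ "{0, 1} \<times> {-1..7}"])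
      (use square_class_range in \<open>auto simp: key_def\<close>)
  then obtain X k where X: "X \<subseteq> C" "card X = 4" and k: "\<And>i. i \<in> X \<Longrightarrow> key i = k" by blast
  have fX: "finite X" "X \<noteq> {}" using X by (auto simp: card_ge_0_finite)
  define K where "K = Max (v ` X)"
  obtain i0 where i0: "i0 \<in> X" "v i0 = K" using Max_in[of "v ` X"] fX unfolding K_def by fastforce
  have vK: "v i \<le> K" if "i \<in> X" for i unfolding K_def using that fX by simp
  have cls: "square_class p (u i) = square_class p (u i0)" and par: "even (K - v i)" if "i \<in> X" for i
  proof -
    have "key i = key i0" using k that i0 by simp
    then show "square_class p (u i) = square_class p (u i0)" unfolding key_def by simp
    have "v i mod 2 = K mod 2" using \<open>key i = key i0\<close> i0 unfolding key_def by simp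
    then show "even (K - v i)" using vK[OF that] by presburger
  qed
  define t where "t = multiplicity p M"
  have pW: "p ^ (6 * (K + t)) dvd W ^ 6"
  proof -
    have "p ^ K dvd a i0" using i0 unfolding v_def by (metis multiplicity_dvd)
    also have "a i0 dvd (\<Prod>i\<in>C. a i)" using C i0 X by (intro dvd_prodI) auto
    finally have "p ^ K * p ^ t dvd W" unfolding W_def t_def by (intro mult_dvd_mono multiplicity_dvd)
    then have "(p ^ K * p ^ t) ^ 6 dvd W ^ 6" by (rule dvd_power_same)
    then show ?thesis by (simp only: power_add[symmetric] power_mult[symmetric] mult.commute)
  qed
  \<comment> \<open>If the four terms are all highly divisible by p, then p^t divides their
    variables, which may be replaced by arbitrary multiples of p^t. Otherwise one term has small
    valuation, and rescaling its variable by some s close to 1 realizes the whole shift.\<close>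
  show ?thesis
  proof (cases "\<forall>i\<in>X. p ^ (K + 2 * t) dvd a i * (w i)\<^sup>2")
    case True
    have "p ^ (K + 2 * t) dvd W ^ 6" by (rule dvd_trans[OF le_imp_power_dvd pW]) simp
    then have "p ^ (K + 2 * t) dvd (\<Sum>i\<in>X. a i * (w i)\<^sup>2) + W ^ 6 * z"
      by (intro dvd_add[OF dvd_sum dvd_mult2]) (use True in blast)
    then obtain n where n: "(\<Sum>i\<in>X. a i * (w i)\<^sup>2) + W ^ 6 * z = p ^ (K + 2 * t) * n" by (auto elim: dvdE)
    have "\<exists>y. p ^ f dvd (\<Sum>i\<in>X. p ^ v i * u i * (y i)\<^sup>2) - p ^ K * n"
      by (rule four_same_class_represent[OF p X(2) i0(1)]) (use u X vK cls par in auto)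
    then obtain y where y: "p ^ f dvd (\<Sum>i\<in>X. p ^ v i * u i * (y i)\<^sup>2) - p ^ K * n" by blast
    have "(\<Sum>i\<in>X. p ^ v i * u i * (y i)\<^sup>2) = (\<Sum>i\<in>X. a i * (y i)\<^sup>2)"
      by (rule sum.cong) (use u X in \<open>auto simp: v_def\<close>)
    then have y: "p ^ f dvd (\<Sum>i\<in>X. a i * (y i)\<^sup>2) - p ^ K * n" using y by simp
    define w' where "w' i = (if i \<in> X then p ^ t * y i else w i)" for i
    have "p ^ t dvd w' i - w i" if "i \<in> C" for i
    proof (cases "i \<in> X")
      case iX: True
      have "p ^ (v i + 2 * t) dvd p ^ (K + 2 * t)" using vK[OF iX] by (simp add: le_imp_power_dvd)
      also have "p ^ (K + 2 * t) dvd a i * (w i)\<^sup>2" using True iX by blast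
      also have "a i * (w i)\<^sup>2 = p ^ v i * (u i * (w i)\<^sup>2)" using u[OF that] unfolding v_def by simp
      finally have "p ^ v i * p ^ (2 * t) dvd p ^ v i * (u i * (w i)\<^sup>2)" by (simp only: power_add)
      then have "p ^ (2 * t) dvd u i * (w i)\<^sup>2" using p by (subst (asm) dvd_mult_cancel_left) auto
      moreover have "coprime (p ^ (2 * t)) (u i)" using p u[OF that]
        by (metis coprime_power_left_iff prime_imp_coprime)
      ultimately have "p ^ (2 * t) dvd (w i)\<^sup>2" by (simp add: coprime_dvd_mult_right_iff)
      then have "(p ^ t)\<^sup>2 dvd (w i)\<^sup>2" by (simp only: power_mult[symmetric] mult.commute)
      then have "p ^ t dvd w i" by (simp only: pow_divides_pow_iff zero_less_numeral)
      then show ?thesis unfolding w'_def using iX by simp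
    qed (simp add: w'_def)
    moreover have "p ^ f dvd (\<Sum>i\<in>C. a i * (w' i)\<^sup>2) - (\<Sum>i\<in>C. a i * (w i)\<^sup>2) - W ^ 6 * z"
    proof -
      have "(\<Sum>i\<in>C. a i * (w' i)\<^sup>2) = (\<Sum>i\<in>C - X. a i * (w' i)\<^sup>2) + (\<Sum>i\<in>X. a i * (w' i)\<^sup>2)"
        using C X by (intro sum.subset_diff) auto
      also have "(\<Sum>i\<in>C - X. a i * (w' i)\<^sup>2) = (\<Sum>i\<in>C - X. a i * (w i)\<^sup>2)"
        by (rule sum.cong) (auto simp: w'_def)
      also have "(\<Sum>i\<in>X. a i * (w' i)\<^sup>2) = p ^ (2 * t) * (\<Sum>i\<in>X. a i * (y i)\<^sup>2)"
        unfolding sum_distrib_left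
        by (rule sum.cong) (simp_all add: w'_def power_mult_distrib power_mult[symmetric] mult.commute mult.left_commute)
      finally have 1: "(\<Sum>i\<in>C. a i * (w' i)\<^sup>2) = (\<Sum>i\<in>C - X. a i * (w i)\<^sup>2) + p ^ (2 * t) * (\<Sum>i\<in>X. a i * (y i)\<^sup>2)" .
      have 2: "(\<Sum>i\<in>C. a i * (w i)\<^sup>2) = (\<Sum>i\<in>C - X. a i * (w i)\<^sup>2) + (\<Sum>i\<in>X. a i * (w i)\<^sup>2)"
        using C X by (intro sum.subset_diff) auto
      have "(\<Sum>i\<in>C. a i * (w' i)\<^sup>2) - (\<Sum>i\<in>C. a i * (w i)\<^sup>2) - W ^ 6 * z
        = p ^ (2 * t) * (\<Sum>i\<in>X. a i * (y i)\<^sup>2) - ((\<Sum>i\<in>X. a i * (w i)\<^sup>2) + W ^ 6 * z)"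
        unfolding 1 2 by simp
      also have "\<dots> = p ^ (2 * t) * ((\<Sum>i\<in>X. a i * (y i)\<^sup>2) - p ^ K * n)"
        unfolding n by (simp add: power_add algebra_simps)
      finally show ?thesis using y by (simp only: dvd_mult)
    qed
    ultimately show ?thesis unfolding t_def by blast
  next
    case False
    then obtain i where i: "i \<in> X" "\<not> p ^ (K + 2 * t) dvd a i * (w i)\<^sup>2" by blast
    define A where "A = a i * (w i)\<^sup>2"
    have "A \<noteq> 0" using i unfolding A_def by auto
    then obtain h where h: "A = p ^ multiplicity p A * h" "\<not> p dvd h"
      using multiplicity_decompose'[of A p] nu by metis
    define \<tau> where "\<tau> = multiplicity p A"
    have \<tau>: "\<tau> < K + 2 * t" using i(2) unfolding A_def[symmetric] \<tau>_def
      by (meson multiplicity_dvd' not_le_imp_less)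
    \<comment> \<open>c >= t preserves the residue modulo p^t, and c >= 1 is what the lifting of
      squares requires.\<close>
    define c where "c = max 1 t"
    \<comment> \<open>As \<open>\<tau>\<close> < K + 2 * t, either t >= 1 or K >= 1, and the
      exponent is at most 6 * (K + t). The summand 2 pays for the factor 4 when p = 2.\<close>
    have "p ^ (\<tau> + c + 2) dvd W ^ 6"
      by (rule dvd_trans[OF le_imp_power_dvd pW]) (use \<tau> in \<open>auto simp: c_def\<close>)
    then obtain z1 where "W ^ 6 = p ^ (\<tau> + c + 2) * z1" by (auto elim: dvdE)
    then have z1: "W ^ 6 * z = p ^ \<tau> * p ^ c * (p\<^sup>2 * (z1 * z))" by (simp add: power_add power2_eq_square)
    have "\<exists>\<zeta>. p ^ f dvd 4 * h * \<zeta> - p\<^sup>2 * (z1 * z)"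
    proof (cases "p = 2")
      case True
      obtain \<zeta> where "p ^ f dvd h * \<zeta> - z1 * z" using unit_inverse_mod_prime_power[OF p h(2)] by blast
      then have "p ^ f dvd 4 * (h * \<zeta> - z1 * z)" by (rule dvd_mult)
      then show ?thesis using True by (intro exI[of _ \<zeta>]) (simp add: algebra_simps)
    next
      case False
      then have "\<not> p dvd 4 * h" using p h odd_prime_not_dvd_four prime_dvd_mult_iff by blast
      then show ?thesis using unit_inverse_mod_prime_power[OF p] by blast
    qed
    then obtain \<zeta> where \<zeta>: "p ^ f dvd 4 * h * \<zeta> - p\<^sup>2 * (z1 * z)" by blast
    obtain s where s: "p ^ c dvd s - 1" "p ^ f dvd s\<^sup>2 - (1 + 4 * p ^ c * \<zeta>)"
      using square_near_one_mod_prime_power[OF p, of c] unfolding c_def by (meson max.cobounded1)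
    define w' where "w' = w(i := w i * s)"
    have iC: "i \<in> C" using i X by blast
    have "p ^ t dvd w' j - w j" for j
    proof (cases "j = i")
      case True
      have "p ^ t dvd p ^ c" unfolding c_def by (simp add: le_imp_power_dvd)
      then have "p ^ t dvd w i * (s - 1)" using s(1) by (meson dvd_mult dvd_trans)
      then show ?thesis using True unfolding w'_def by (simp add: algebra_simps)
    qed (simp add: w'_def)
    moreover have "p ^ f dvd (\<Sum>i\<in>C. a i * (w' i)\<^sup>2) - (\<Sum>i\<in>C. a i * (w i)\<^sup>2) - W ^ 6 * z"
    proof -
      have 1: "(\<Sum>j\<in>C. a j * (w j)\<^sup>2) = A + (\<Sum>j\<in>C - {i}. a j * (w j)\<^sup>2)"
        unfolding A_def using C iC by (intro sum.remove)
      have "(\<Sum>j\<in>C. a j * (w' j)\<^sup>2) = a i * (w' i)\<^sup>2 + (\<Sum>j\<in>C - {i}. a j * (w' j)\<^sup>2)"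
        using C iC by (intro sum.remove)
      also have "(\<Sum>j\<in>C - {i}. a j * (w' j)\<^sup>2) = (\<Sum>j\<in>C - {i}. a j * (w j)\<^sup>2)"
        by (rule sum.cong) (auto simp: w'_def)
      also have "a i * (w' i)\<^sup>2 = A * s\<^sup>2" unfolding w'_def A_def by (simp add: power_mult_distrib)
      finally have 2: "(\<Sum>j\<in>C. a j * (w' j)\<^sup>2) = A * s\<^sup>2 + (\<Sum>j\<in>C - {i}. a j * (w j)\<^sup>2)" .
      have A: "A = p ^ \<tau> * h" using h(1) unfolding \<tau>_def .
      have "(\<Sum>i\<in>C. a i * (w' i)\<^sup>2) - (\<Sum>i\<in>C. a i * (w i)\<^sup>2) - W ^ 6 * z
        = p ^ \<tau> * h * (s\<^sup>2 - (1 + 4 * p ^ c * \<zeta>)) + p ^ \<tau> * p ^ c * (4 * h * \<zeta> - p\<^sup>2 * (z1 * z))"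
        unfolding 1 2 z1 A by (simp add: algebra_simps)
      then show ?thesis using s(2) \<zeta> by (simp only: dvd_add dvd_mult)
    qed
    ultimately show ?thesis unfolding t_def by blast
  qed
qed

section \<open>From prime powers to arbitrary moduli\<close>

lemma chinese_remainder_prime_powers:
  fixes P :: "int set" and r :: "int \<Rightarrow> int"
  assumes "finite P" "\<And>p. p \<in> P \<Longrightarrow> prime p"
  shows "\<exists>x. \<forall>p\<in>P. p ^ f p dvd x - r p"
  using assms
proof (induction P)
  case (insert p P)
  then obtain x where x: "\<And>q. q \<in> P \<Longrightarrow> q ^ f q dvd x - r q" by auto
  have "coprime (p ^ f p) (\<Prod>q\<in>P. q ^ f q)"
  proof (rule prod_coprime_right)
    fix q assume "q \<in> P"
    then have "prime p" "prime q" "p \<noteq> q" using insert by auto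
    then show "coprime (p ^ f p) (q ^ f q)" by (simp add: primes_coprime)
  qed
  then obtain y where y: "[y = r p] (mod p ^ f p)" "[y = x] (mod (\<Prod>q\<in>P. q ^ f q))"
    using binary_chinese_remainder_int by blast
  have "q ^ f q dvd y - r q" if "q \<in> P" for q
  proof -
    have "q ^ f q dvd (\<Prod>q\<in>P. q ^ f q)" using insert.hyps that by (intro dvd_prodI) auto
    also have "\<dots> dvd y - x" using y(2) by (simp add: cong_iff_dvd_diff)
    finally have "q ^ f q dvd (y - x) + (x - r q)" using x[OF that] by (intro dvd_add)
    then show ?thesis by simp
  qed
  then show ?case using y(1) by (auto simp: cong_iff_dvd_diff)
qed simp

lemma dvd_if_prime_powers_dvd:
  fixes T x :: int
  assumes "T \<noteq> 0" "\<And>p. prime p \<Longrightarrow> p dvd T \<Longrightarrow> p ^ multiplicity p T dvd x"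
  shows "T dvd x"
proof (cases "x = 0")
  case x: False
  have "multiplicity p T \<le> multiplicity p x" if p: "prime p" for p
  proof (cases "p dvd T")
    case True
    have "\<not> is_unit p" using p not_prime_unit by blast
    then show ?thesis by (rule multiplicity_geI[OF x _ assms(2)[OF p True]])
  qed (simp add: not_dvd_imp_multiplicity_0)
  then show ?thesis using assms(1) by (rule multiplicity_le_imp_dvd[rotated])
qed simp

lemma diagonal_form_closed_mod:
  fixes a w :: "nat \<Rightarrow> int" and D M z :: int
  assumes C: "finite C" "card C \<ge> 55" and a: "\<And>i. i \<in> C \<Longrightarrow> a i > 0" and D: "D > 0" and M: "M > 0"
  defines "W \<equiv> (\<Prod>i\<in>C. a i) * M"
  shows "\<exists>w'. (\<forall>i\<in>C. M dvd w' i - w i) \<and>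
     D dvd (\<Sum>i\<in>C. a i * (w' i)\<^sup>2) - (\<Sum>i\<in>C. a i * (w i)\<^sup>2) - W ^ 6 * z"
proof -
  \<comment> \<open>Modulo D * M, one use of the Chinese remainder theorem both keeps the residues
    modulo M and controls the form modulo D.\<close>
  define T where "T = D * M"
  have T: "T > 0" unfolding T_def using D M by simp
  define P where "P = prime_factors T"
  have P: "finite P" "\<And>p. p \<in> P \<Longrightarrow> prime p" unfolding P_def by auto
  let ?f = "\<lambda>p. multiplicity p T"
  let ?H = "\<lambda>w. \<Sum>i\<in>C. a i * (w i)\<^sup>2"
  have "\<exists>g. \<forall>p\<in>P. (\<forall>i\<in>C. p ^ multiplicity p M dvd g p i - w i) \<and> p ^ ?f p dvd ?H (g p) - ?H w - W ^ 6 * z"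
  proof (rule bchoice, rule ballI)
    fix p assume "p \<in> P"
    then show "\<exists>w'. (\<forall>i\<in>C. p ^ multiplicity p M dvd w' i - w i) \<and> p ^ ?f p dvd ?H w' - ?H w - W ^ 6 * z"
    unfolding W_def using diagonal_form_closed_mod_prime_power[OF C _ P(2) M, where a = a and w = w] a by blast
  qed
  then obtain g where g: "\<And>p i. p \<in> P \<Longrightarrow> i \<in> C \<Longrightarrow> p ^ multiplicity p M dvd g p i - w i"
     "\<And>p. p \<in> P \<Longrightarrow> p ^ ?f p dvd ?H (g p) - ?H w - W ^ 6 * z" by blast
  have "\<forall>i. \<exists>x. \<forall>p\<in>P. p ^ ?f p dvd x - g p i"
    by (rule allI, rule chinese_remainder_prime_powers) (use P in auto)
  then have "\<exists>w'. \<forall>i. \<forall>p\<in>P. p ^ ?f p dvd w' i - g p i" by (rule choice)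
  then obtain w' where w': "\<And>p i. p \<in> P \<Longrightarrow> p ^ ?f p dvd w' i - g p i" by blast
  have "M dvd w' i - w i" if "i \<in> C" for i
  proof (rule dvd_if_prime_powers_dvd)
    fix p assume p: "prime p" "p dvd M"
    then have pP: "p \<in> P" unfolding P_def T_def using D M by (simp add: in_prime_factors_iff)
    have "p ^ multiplicity p M dvd p ^ ?f p"
      unfolding T_def using D M by (intro le_imp_power_dvd dvd_imp_multiplicity_le) auto
    then have "p ^ multiplicity p M dvd (w' i - g p i) + (g p i - w i)"
      by (intro dvd_add dvd_trans[OF _ w'[OF pP]] g(1)[OF pP that])
    then show "p ^ multiplicity p M dvd w' i - w i" by simp
  qed (use M in simp)
  moreover have "T dvd ?H w' - ?H w - W ^ 6 * z"
  proof (rule dvd_if_prime_powers_dvd)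
    fix p assume p: "prime p" "p dvd T"
    then have pP: "p \<in> P" unfolding P_def using T by (simp add: in_prime_factors_iff)
    have "?H w' - ?H (g p) = (\<Sum>i\<in>C. (w' i - g p i) * (a i * (w' i + g p i)))"
      unfolding sum_subtractf[symmetric] by (rule sum.cong) (auto simp: algebra_simps power2_eq_square)
    then have "p ^ ?f p dvd ?H w' - ?H (g p)" using w'[OF pP] by (simp add: dvd_sum)
    then have "p ^ ?f p dvd (?H w' - ?H (g p)) + (?H (g p) - ?H w - W ^ 6 * z)" using g(2)[OF pP] by (rule dvd_add)
    moreover have "(?H w' - ?H (g p)) + (?H (g p) - ?H w - W ^ 6 * z) = ?H w' - ?H w - W ^ 6 * z" by linarith
    ultimately show "p ^ ?f p dvd ?H w' - ?H w - W ^ 6 * z" by (simp only:)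
  qed (use T in simp)
  then have "D dvd ?H w' - ?H w - W ^ 6 * z" unfolding T_def by (rule dvd_mult_left)
  ultimately show ?thesis by blast
qed

text \<open>Completing the square: 8 * \<alpha> * P_s(x) = w^2 - (s - 4)^2 with w = 2 * \<alpha> * x
  - (s - 4). Equal m_i make the factor 8 * \<alpha> common to all terms, and a new w comes from an
  integer x if its residue modulo 2 * \<alpha> is kept. Hence M = 2 * \<alpha> and E = W^6.\<close>

lemma reps_closed_mod:
  assumes C: "finite C" "card C \<ge> 55" and am: "\<And>i. i \<in> C \<Longrightarrow> a i \<ge> 1 \<and> m i = s" and s: "s \<ge> 3"
  shows "\<exists>E>0. \<forall>D>0. \<forall>n \<in> reps a m C. \<forall>z. \<exists>n' \<in> reps a m C. D dvd n' - n - E * z"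
proof -
  define \<alpha> where "\<alpha> = int s - 2"
  have \<alpha>: "\<alpha> > 0" unfolding \<alpha>_def using s by simp
  define W where "W = (\<Prod>i\<in>C. int (a i)) * (2 * \<alpha>)"
  have a: "int (a i) > 0" if "i \<in> C" for i using am[OF that] by simp
  have W: "W > 0" unfolding W_def using \<alpha> a by (simp add: prod_pos)
  let ?w = "\<lambda>x i. 2 * \<alpha> * x i - (int s - 4)"
  let ?F = "\<lambda>x. \<Sum>i\<in>C. int (a i) * polygonal (m i) (x i)"
  have sq: "int (a i) * (?w x i)\<^sup>2 = 8 * \<alpha> * (int (a i) * polygonal (m i) (x i)) + int (a i) * (int s - 4)\<^sup>2"
    if "i \<in> C" for i and x :: "nat \<Rightarrow> int"
  proof -
    have "8 * \<alpha> * polygonal (m i) (x i) = 4 * \<alpha> * (2 * polygonal s (x i))" using am[OF that] by simp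
    also have "\<dots> = (?w x i)\<^sup>2 - (int s - 4)\<^sup>2" unfolding two_times_polygonal \<alpha>_def
      by (simp add: algebra_simps power2_eq_square)
    finally have "(?w x i)\<^sup>2 = 8 * \<alpha> * polygonal (m i) (x i) + (int s - 4)\<^sup>2" by linarith
    then show ?thesis by (simp only:) (simp add: algebra_simps)
  qed
  have H: "(\<Sum>i\<in>C. int (a i) * (?w x i)\<^sup>2) = 8 * \<alpha> * ?F x + (\<Sum>i\<in>C. int (a i) * (int s - 4)\<^sup>2)" for x
    unfolding sum_distrib_left sum.distrib[symmetric] by (rule sum.cong[OF refl]) (rule sq)
  have "\<exists>n' \<in> reps a m C. D dvd n' - n - W ^ 6 * z" if D: "D > 0" and n: "n \<in> reps a m C" for D n z
  proof -
    obtain x where x: "n = ?F x" using n unfolding reps_def by blast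
    \<comment> \<open>Modulus and shift both carry the factor 8 * \<alpha>, which is cancelled on
      the way back from w to x.\<close>
    have D': "8 * \<alpha> * D > 0" using D \<alpha> by simp
    obtain w' where w': "\<And>i. i \<in> C \<Longrightarrow> 2 * \<alpha> dvd w' i - ?w x i"
      and d: "8 * \<alpha> * D dvd (\<Sum>i\<in>C. int (a i) * (w' i)\<^sup>2) - (\<Sum>i\<in>C. int (a i) * (?w x i)\<^sup>2) - W ^ 6 * (8 * \<alpha> * z)"
      using diagonal_form_closed_mod[OF C _ D', where a = "\<lambda>i. int (a i)" and M = "2 * \<alpha>" and w = "?w x" and z = "8 * \<alpha> * z"]
        \<alpha> a unfolding W_def by auto
    define x' where "x' i = x i + (w' i - ?w x i) div (2 * \<alpha>)" for i
    have "w' i = ?w x' i" if iC: "i \<in> C" for i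
    proof -
      obtain k where k: "w' i - ?w x i = 2 * \<alpha> * k" using w'[OF iC] unfolding dvd_def by blast
      then have "x' i = x i + k" unfolding x'_def using \<alpha> by simp
      then show ?thesis using k by (simp add: algebra_simps)
    qed
    then have "(\<Sum>i\<in>C. int (a i) * (w' i)\<^sup>2) = (\<Sum>i\<in>C. int (a i) * (?w x' i)\<^sup>2)" by simp
    then have "8 * \<alpha> * D dvd 8 * \<alpha> * (?F x' - ?F x - W ^ 6 * z)" using d unfolding H by (simp add: algebra_simps)
    then have "D dvd ?F x' - ?F x - W ^ 6 * z" using \<alpha> by (subst (asm) dvd_mult_cancel_left) auto
    then show ?thesis unfolding x by (intro bexI[of _ "?F x'"] repsI[where x = x']) auto
  qed
  then show ?thesis using W by (intro exI[of _ "W ^ 6"]) auto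
qed

section \<open>Pigeonhole at one scale, and assembly of the prefix\<close>

section \<open>Universal prefixes\<close>

lemma exists_popular_residue:
  fixes S :: "int set" and d :: int
  assumes "finite S" "d > 0"
  shows "\<exists>\<rho>. card S \<le> nat d * card {b \<in> S. b mod d = \<rho>}"
proof (rule ccontr)
  assume no: "\<not> ?thesis"
  have "card S = card (\<Union>\<rho>\<in>{0..<d}. {b \<in> S. b mod d = \<rho>})"
    by (rule arg_cong[where f = card]) (use assms(2) in auto)
  also have "\<dots> \<le> (\<Sum>\<rho>\<in>{0..<d}. card {b \<in> S. b mod d = \<rho>})" by (rule card_UN_le) simp
  finally have "nat d * card S \<le> (\<Sum>\<rho>\<in>{0..<d}. nat d * card {b \<in> S. b mod d = \<rho>})"
    by (simp flip: sum_distrib_left)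
  also have "\<dots> < (\<Sum>\<rho>\<in>{0..<d}. card S)"
    using no assms(2) by (intro sum_strict_mono) (auto simp: not_le)
  finally show False by simp
qed

text \<open>In the application A and A' are the value sets before and after adjoining one term with
  values V. Take u from the almost full progression, a residue \<rho> that is popular among the b in
  S below H, and f in R congruent to n - u - \<rho>. Then all n - f - b lie on the progression at
  distinct places, too many for all of them to be gaps.\<close>

lemma represent_at_scale:
  fixes A A' V S R :: "int set" and d n L :: int and \<delta>0 \<delta>1 :: real
  assumes A: "A \<subseteq> {0..}" and AV: "\<And>u v. u \<in> A \<Longrightarrow> v \<in> V \<Longrightarrow> u + v \<in> A'"
    and V: "V \<subseteq> {0..}" and d: "d > 0"
    and basis: "\<And>k. k \<ge> 0 \<Longrightarrow> \<exists>vs. set vs \<subseteq> V \<and> length vs = 8 \<and> sum_list vs = d * k"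
  defines "N \<equiv> n + 1"
  defines "H \<equiv> N div 3"
  assumes N: "N \<ge> 12" "N \<ge> d" "N \<ge> 3 * L + 3"
    and step: "card ((A' - A) \<inter> {0..<N}) * T \<le> nat N"
    and \<delta>0: "\<delta>0 > 0" "\<delta>0 * H \<le> card (A \<inter> {0..<H})"
    and \<delta>1: "\<delta>1 > 0" "\<delta>1 * H \<le> card (S \<inter> {0..<H})"
    and T: "real T * \<delta>0 * \<delta>1 > 256"
    and R: "R \<subseteq> {0..}" "\<And>k. \<exists>f\<in>R. f \<le> L \<and> d dvd f - k"
  shows "\<exists>f\<in>R. \<exists>b\<in>S. \<exists>v\<in>A. n = f + b + v"
proof -
  have H: "H \<ge> 1" "3 * H \<le> N" "N \<le> 4 * H" unfolding H_def using N(1) by simp_all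
  have Hr: "real_of_int N / 4 \<le> H" "real_of_int H > 0" using H by linarith+
  have "0 < \<delta>0 * H" using \<delta>0(1) Hr(2) by (rule mult_pos_pos)
  then have "card (A \<inter> {0..<H}) \<noteq> 0" using \<delta>0(2) by linarith
  then have ne: "A \<inter> {0..<H} \<noteq> {}" by auto
  let ?g = "card ((A' - A) \<inter> {0..<N})"
  define bad where "bad u = {k. 0 \<le> k \<and> u + d * k < N \<and> u + d * k \<notin> A}" for u
  have "N \<ge> 0" using N by simp
  then obtain u where u: "u \<in> A" "u < H"
    and le: "card (bad u) * card (A \<inter> {0..<H}) \<le> 8 * ?g * nat (N div d + 1)"
    using exists_almost_full_progression[OF A AV V d _ basis ne, of N] unfolding bad_def by blast
  have u0: "u \<ge> 0" using u A by auto
  obtain \<rho> where \<rho>: "card (S \<inter> {0..<H}) \<le> nat d * card {b \<in> S \<inter> {0..<H}. b mod d = \<rho>}"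
    using exists_popular_residue[of "S \<inter> {0..<H}" d] d by auto
  define Bs where "Bs = {b \<in> S \<inter> {0..<H}. b mod d = \<rho>}"
  obtain f where f: "f \<in> R" "f \<le> L" "d dvd f - (n - u - \<rho>)" using R(2) by blast
  have f0: "f \<ge> 0" using f R by auto
  \<comment> \<open>256 = 8 * 2 * 4 * 4: eight steps make up a multiple of d, N / d + 1 <= 2 * N /
    d, and H >= N / 4 is used once for each density.\<close>
  have less: "card (bad u) < card Bs"
  proof -
    define x where "x = real (card (bad u))"
    define y where "y = real (card Bs)"
    define D where "D = real_of_int d"
    define M where "M = real_of_int N"
    have D: "D > 0" "D \<le> M" "M > 0" unfolding D_def M_def using d N by simp_all
    have "nat (N div d + 1) = real_of_int (N div d) + 1" using N d by (simp add: pos_imp_zdiv_nonneg_iff)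
    also have "\<dots> \<le> M / D + 1" unfolding M_def D_def using real_of_int_div4[of N d] by simp
    also have "\<dots> \<le> 2 * M / D" using D by (simp add: field_simps)
    finally have q: "real (nat (N div d + 1)) \<le> 2 * M / D" .
    have T0: "real T > 0" using T \<delta>0(1) \<delta>1(1) by (cases "T = 0") auto
    have "real (?g * T) \<le> real (nat N)" using step by (simp only: of_nat_le_iff)
    then have gT: "real ?g * T \<le> M" unfolding M_def using N by simp
    have "\<delta>0 * (M / 4) \<le> \<delta>0 * H" unfolding M_def using \<delta>0(1) Hr(1) by (intro mult_left_mono) simp_all
    then have "\<delta>0 * (M / 4) \<le> card (A \<inter> {0..<H})" using \<delta>0(2) by linarith
    then have "x * (\<delta>0 * (M / 4)) \<le> x * card (A \<inter> {0..<H})"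
      by (rule mult_left_mono) (simp add: x_def)
    also have "\<dots> = real (card (bad u) * card (A \<inter> {0..<H}))" unfolding x_def by simp
    also have "\<dots> \<le> real (8 * ?g * nat (N div d + 1))" using le by (simp only: of_nat_le_iff)
    also have "\<dots> = 8 * real ?g * nat (N div d + 1)" by simp
    also have "\<dots> \<le> 8 * real ?g * (2 * M / D)" using q by (intro mult_left_mono) auto
    finally have "x * (\<delta>0 * (M / 4)) * T \<le> 8 * real ?g * (2 * M / D) * T" using T0 by (intro mult_right_mono) auto
    also have "\<dots> = (real ?g * T) * (16 * M / D)" by simp
    also have "\<dots> \<le> M * (16 * M / D)" using gT D by (intro mult_right_mono) auto
    finally have "x * \<delta>0 * T * (M / 4) \<le> (64 * M / D) * (M / 4)" by (simp add: algebra_simps)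
    then have X: "x * \<delta>0 * T \<le> 64 * M / D" using D by (simp only: mult_le_cancel_right_pos)
    have "\<delta>1 * (M / 4) \<le> \<delta>1 * H" unfolding M_def using \<delta>1 Hr by (intro mult_left_mono) auto
    also have "\<dots> \<le> real (nat d * card Bs)" using \<delta>1(2) \<rho> unfolding Bs_def by linarith
    also have "\<dots> = D * y" using d unfolding D_def y_def by simp
    finally have Y: "\<delta>1 * (M / 4) \<le> D * y" .
    have "x * \<delta>0 * T * \<delta>1 \<le> 64 * M / D * \<delta>1" using X \<delta>1 by (intro mult_right_mono) auto
    also have "\<dots> = 256 / D * (\<delta>1 * (M / 4))" by simp
    also have "\<dots> \<le> 256 / D * (D * y)" using Y D by (intro mult_left_mono) auto
    also have "\<dots> = 256 * y" using D by simp
    finally have xy: "x * (real T * \<delta>0 * \<delta>1) \<le> 256 * y" by (simp add: algebra_simps)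
    have "y > 0"
    proof -
      have "0 < \<delta>1 * (M / 4)" using \<delta>1 D by simp
      then have "0 < D * y" using Y by linarith
      then show ?thesis using D(1) by (simp add: zero_less_mult_iff)
    qed
    show ?thesis
    proof (cases "x = 0")
      case True
      then show ?thesis using \<open>y > 0\<close> unfolding x_def y_def by simp
    next
      case False
      then have "x > 0" unfolding x_def by simp
      then have "x * 256 < x * (real T * \<delta>0 * \<delta>1)" using T by (intro mult_strict_left_mono)
      then have "x < y" using xy by linarith
      then show ?thesis unfolding x_def y_def by simp
    qed
  qed
  have "\<exists>b\<in>Bs. n - f - b \<in> A"
  proof (rule ccontr)
    assume no: "\<not> ?thesis"
    let ?k = "\<lambda>b. (n - f - b - u) div d"
    have k: "u + d * ?k b = n - f - b" "?k b \<ge> 0" if "b \<in> Bs" for b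
    proof -
      have "b mod d = \<rho>" using that unfolding Bs_def by blast
      then have "d dvd b - \<rho>" by (metis dvd_minus_mod)
      then have "d dvd - ((f - (n - u - \<rho>)) + (b - \<rho>))" using f(3) by (simp only: dvd_minus_iff dvd_add)
      moreover have "- ((f - (n - u - \<rho>)) + (b - \<rho>)) = n - f - b - u" by linarith
      ultimately have "d dvd n - f - b - u" by (simp only:)
      then have "d * ?k b = n - f - b - u" by (rule dvd_mult_div_cancel)
      then show "u + d * ?k b = n - f - b" by linarith
      \<comment> \<open>A third of N for each of u, b and f keeps the place in the progression
        nonnegative.\<close>
      have "b < H" using that unfolding Bs_def by simp
      then have "n - f - b - u \<ge> 0" using f(2) u(2) H(2) N(3) unfolding N_def by linarith
      then show "?k b \<ge> 0" using d by (simp add: pos_imp_zdiv_nonneg_iff)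
    qed
    have "inj_on ?k Bs"
    proof (rule inj_onI)
      fix b c assume bc: "b \<in> Bs" "c \<in> Bs" "?k b = ?k c"
      have "n - f - b = u + d * ?k b" using k(1)[OF bc(1)] by (rule sym)
      also have "\<dots> = u + d * ?k c" by (rule arg_cong[OF bc(3), of "\<lambda>t. u + d * t"])
      also have "\<dots> = n - f - c" by (rule k(1)[OF bc(2)])
      finally have "n - f - b = n - f - c" .
      then show "b = c" by simp
    qed
    moreover have "?k ` Bs \<subseteq> bad u"
    proof
      fix z assume "z \<in> ?k ` Bs"
      then obtain b where b: "b \<in> Bs" "z = ?k b" by blast
      have "b \<ge> 0" using b unfolding Bs_def by simp
      then have "n - f - b < N" using f0 unfolding N_def by simp
      then show "z \<in> bad u" unfolding b(2) bad_def using k[OF b(1)] no b(1) by simp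
    qed
    moreover have "finite (bad u)"
    proof (rule finite_subset)
      show "bad u \<subseteq> {0..N}"
      proof
        fix k assume "k \<in> bad u"
        then have "0 \<le> k" "u + d * k < N" unfolding bad_def by auto
        moreover have "1 * k \<le> d * k" using d \<open>0 \<le> k\<close> by (intro mult_right_mono) auto
        ultimately show "k \<in> {0..N}" using u0 by simp
      qed
    qed simp
    ultimately have "card Bs \<le> card (bad u)" by (rule card_inj_on_le)
    then show False using less by simp
  qed
  then obtain b where "b \<in> Bs" "n - f - b \<in> A" by blast
  then show ?thesis using f(1) unfolding Bs_def by (intro bexI[of _ f] bexI[of _ b] bexI[of _ "n - f - b"]) auto
qed

lemma polygonal_eight_basis:
  assumes "k \<ge> 0"
  shows "\<exists>vs. set vs \<subseteq> range (\<lambda>x. int a * polygonal m x) \<and> length vs = 8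
    \<and> sum_list vs = int a * (int m - 2) * k"
proof -
  \<comment> \<open>Each of the four squares takes one pair of opposite arguments, hence eight
    values.\<close>
  obtain b1 b2 b3 b4 where k: "k = b1\<^sup>2 + b2\<^sup>2 + b3\<^sup>2 + b4\<^sup>2"
    using four_squares_nonneg[OF assms] unfolding four_squares_def by blast
  have pm: "polygonal m x + polygonal m (- x) = (int m - 2) * x\<^sup>2" for x
    using two_times_polygonal[of m x] two_times_polygonal[of m "- x"] by simp
  let ?vs = "map (\<lambda>x. int a * polygonal m x) [b1, - b1, b2, - b2, b3, - b3, b4, - b4]"
  have "sum_list ?vs = int a * ((polygonal m b1 + polygonal m (- b1)) + (polygonal m b2 + polygonal m (- b2))
     + (polygonal m b3 + polygonal m (- b3)) + (polygonal m b4 + polygonal m (- b4)))"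
    by (simp add: algebra_simps)
  also have "\<dots> = int a * (int m - 2) * k" unfolding pm k by (simp add: algebra_simps)
  finally show ?thesis by (intro exI[of _ ?vs]) auto
qed

lemma reps_Un_split:
  assumes "finite J" "finite K" "J \<inter> K = {}" "n \<in> reps a m (J \<union> K)"
  obtains u v where "u \<in> reps a m J" "v \<in> reps a m K" "n = u + v"
proof -
  obtain x where "n = (\<Sum>j\<in>J \<union> K. int (a j) * polygonal (m j) (x j))"
    using assms(4) unfolding reps_def by blast
  then have "n = (\<Sum>j\<in>J. int (a j) * polygonal (m j) (x j)) + (\<Sum>j\<in>K. int (a j) * polygonal (m j) (x j))"
    using assms by (simp add: sum.union_disjoint)
  then show ?thesis using that repsI by blast
qed

lemma exists_prefix_representing_initial_segment:
  assumes "\<And>n::nat. \<exists>r. int n \<in> reps a m {..<r}"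
  shows "\<exists>r. \<forall>n<N. int n \<in> reps a m {..<r}"
proof (induction N)
  case (Suc N)
  then obtain r where r: "\<forall>n<N. int n \<in> reps a m {..<r}" by blast
  obtain q where q: "int N \<in> reps a m {..<q}" using assms by blast
  have "reps a m {..<r} \<subseteq> reps a m {..<max r q}" "reps a m {..<q} \<subseteq> reps a m {..<max r q}"
    by (rule reps_mono; auto)+
  then have "\<forall>n<Suc N. int n \<in> reps a m {..<max r q}" using r q by (auto simp: less_Suc_eq)
  then show ?case by blast
qed simp

text \<open>Since the m_i are bounded, some 55 indices C share one value. A prefix that contains C
  and represents 0, ..., E - 1 suffices: in a representation of n mod E the part coming from C is
  moved by E * (n div E) modulo D, and the rest is left alone.\<close>

lemma exists_prefix_covering_residues:
  assumes am: "\<And>i. 1 \<le> a i \<and> 3 \<le> m i \<and> m i \<le> B"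
    and rep: "\<And>n::nat. \<exists>r. int n \<in> reps a m {..<r}"
  shows "\<exists>r. \<forall>D>0. \<forall>n. \<exists>n' \<in> reps a m {..<r}. D dvd n' - n"
proof -
  have "finite (range m)" by (rule finite_subset[of _ "{..B}"]) (use am in auto)
  then obtain i0 where "infinite {i \<in> UNIV. m i = m i0}"
    using pigeonhole_infinite[of "UNIV :: nat set" m] by auto
  then obtain C where C: "finite C" "card C = 55" "C \<subseteq> {i. m i = m i0}"
    using infinite_arbitrarily_large[of "{i. m i = m i0}" 55] by auto
  have Cam: "\<And>i. i \<in> C \<Longrightarrow> a i \<ge> 1 \<and> m i = m i0" using C(3) am by auto
  have m0: "m i0 \<ge> 3" using am by blast
  have C55: "card C \<ge> 55" using C(2) by simp
  obtain E where E: "E > 0" and closed: "\<And>D n z. D > 0 \<Longrightarrow> n \<in> reps a m C \<Longrightarrow> \<exists>n' \<in> reps a m C. D dvd n' - n - E * z"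
    using reps_closed_mod[of C a m "m i0"] C(1) C55 Cam m0 by blast
  obtain q where q: "\<forall>n<nat E. int n \<in> reps a m {..<q}"
    using exists_prefix_representing_initial_segment[OF rep] by blast
  obtain q' where q': "C \<subseteq> {..<q'}" using C(1) finite_nat_iff_bounded by blast
  define r where "r = max q q'"
  have Cr: "C \<subseteq> {..<r}" using q' unfolding r_def by auto
  have "\<exists>n' \<in> reps a m {..<r}. D dvd n' - n" if D: "D > 0" for D n
  proof -
    have "int (nat (n mod E)) = n mod E" "nat (n mod E) < nat E" using E by simp_all
    then have "n mod E \<in> reps a m {..<q}" using q by metis
    moreover have "reps a m {..<q} \<subseteq> reps a m {..<r}" by (rule reps_mono) (auto simp: r_def)
    moreover have "{..<r} = C \<union> ({..<r} - C)" using Cr by blast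
    ultimately have "n mod E \<in> reps a m (C \<union> ({..<r} - C))" by (metis subsetD)
    then obtain u v where u: "u \<in> reps a m C" and v: "v \<in> reps a m ({..<r} - C)" and uv: "n mod E = u + v"
      by (rule reps_Un_split[rotated 3]) (use C in auto)
    obtain u' where u': "u' \<in> reps a m C" "D dvd u' - u - E * (n div E)"
      using closed[OF D u] by blast
    have "u' + v \<in> reps a m (C \<union> ({..<r} - C))" using C u' v by (intro reps_Un_add) auto
    moreover have "C \<union> ({..<r} - C) = {..<r}" using Cr by blast
    ultimately have "u' + v \<in> reps a m {..<r}" by (simp only:)
    moreover have "u' + v - n = u' - u - E * (n div E)" using uv mult_div_mod_eq[of E n] by linarith
    then have "D dvd u' + v - n" using u'(2) by (simp only:)
    ultimately show ?thesis by blast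
  qed
  then show ?thesis by blast
qed

lemma exists_universal_prefix:
  assumes am: "\<And>i. 1 \<le> a i \<and> 3 \<le> m i \<and> m i \<le> B"
    and rep: "\<And>n::nat. \<exists>r. int n \<in> reps a m {..<r}"
  shows "\<exists>r. \<forall>n::nat. int n \<in> reps a m {..<r}"
proof -
  obtain r where r: "\<And>D n. D > 0 \<Longrightarrow> \<exists>n' \<in> reps a m {..<r}. D dvd n' - n"
    using exists_prefix_covering_residues[OF am rep] by blast
  have am': "a i \<ge> 1 \<and> m i \<ge> 3" for i using am by blast
  have nonneg: "reps a m J \<subseteq> {0..}" for J by (rule reps_nonneg) (use am' in blast)
  \<comment> \<open>Three disjoint blocks: the indices below r supply the residues, J1 supplies the
    b, and J s, which starts with three indices and gains \<open>idx s\<close> at step s, supplies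
    the progression.\<close>
  define J1 where "J1 = {r..<r+3}"
  define J where "J s = {r+3..<r+6+s}" for s
  define idx where "idx s = r + 6 + s" for s
  define d where "d s = int (a (idx s)) * (int (m (idx s)) - 2)" for s
  define V where "V s = range (\<lambda>x. int (a (idx s)) * polygonal (m (idx s)) x)" for s
  have d: "d s > 0" for s
    unfolding d_def using am'[of "idx s"] by (intro mult_pos_pos) auto
  obtain \<delta>0 where \<delta>0: "\<delta>0 > 0" "\<And>N. N \<ge> 1 \<Longrightarrow> \<delta>0 * real_of_int N \<le> card (reps a m (J 0) \<inter> {0..<N})"
    using reps_three_positive_density[of "J 0" a m] am' unfolding J_def by auto
  obtain \<delta>1 where \<delta>1: "\<delta>1 > 0" "\<And>N. N \<ge> 1 \<Longrightarrow> \<delta>1 * real_of_int N \<le> card (reps a m J1 \<inter> {0..<N})"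
    using reps_three_positive_density[of J1 a m] am' unfolding J1_def by auto
  obtain T :: nat where "256 / (\<delta>0 * \<delta>1) < real T" using reals_Archimedean2 by blast
  then have T: "real T * \<delta>0 * \<delta>1 > 256" using \<delta>0(1) \<delta>1(1) by (simp add: field_simps)
  have "\<forall>s c. \<exists>f. f \<in> reps a m {..<r} \<and> d s dvd f - c" using r[OF d] by blast
  then obtain F where F: "\<And>s c. F s c \<in> reps a m {..<r}" "\<And>s c. d s dvd F s c - c" by metis
  \<comment> \<open>One bound for representatives of all residues modulo all d s with s < T. They
    are nonnegative, so their sum dominates each of them.\<close>
  define L where "L = (\<Sum>s<T. \<Sum>c\<in>{0..<d s}. F s c)"
  have F0: "F s c \<ge> 0" for s c using F(1) nonneg by fastforce
  have L: "\<exists>f \<in> reps a m {..<r}. f \<le> L \<and> d s dvd f - c" if s: "s < T" for s c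
  proof -
    have c: "c mod d s \<in> {0..<d s}" using d by simp
    have "F s (c mod d s) \<le> (\<Sum>c\<in>{0..<d s}. F s c)" using c F0 by (intro member_le_sum) auto
    also have "\<dots> \<le> L" unfolding L_def using s F0 by (intro member_le_sum sum_nonneg) auto
    finally have "F s (c mod d s) \<le> L" .
    moreover have "d s dvd (F s (c mod d s) - c mod d s) - d s * (c div d s)"
      by (intro dvd_diff F(2)) simp
    moreover have "(F s (c mod d s) - c mod d s) - d s * (c div d s) = F s (c mod d s) - c"
      using mult_div_mod_eq[of "d s" c] by linarith
    ultimately show ?thesis using F(1) by metis
  qed
  define dm where "dm = (\<Sum>s<T. d s)"
  have dm: "d s \<le> dm" if "s < T" for s
    unfolding dm_def using that d by (intro member_le_sum) (auto simp: less_imp_le)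
  define n0 where "n0 = 12 + dm + (3 * L + 3)"
  have L0: "L \<ge> 0" unfolding L_def using F0 by (intro sum_nonneg) auto
  have dm0: "dm \<ge> 0" unfolding dm_def using d by (intro sum_nonneg) (simp add: less_imp_le)
  have Jsub: "J s \<subseteq> J (Suc s)" "finite (J s)" for s unfolding J_def by auto
  define R where "R = r + 6 + T"
  have large: "n \<in> reps a m {..<R}" if n: "n \<ge> n0" for n
  proof -
    define N where "N = n + 1"
    have N: "N \<ge> 12" "N \<ge> 3 * L + 3" "N \<ge> dm" using n L0 dm0 unfolding n0_def N_def by linarith+
    define c where "c s = card (reps a m (J s) \<inter> {0..<N})" for s
    have mono: "reps a m (J s) \<subseteq> reps a m (J (Suc s))" for s by (rule reps_mono) (use Jsub in auto)
    have g: "int (card ((reps a m (J (Suc s)) - reps a m (J s)) \<inter> {0..<N})) = int (c (Suc s)) - int (c s)" for s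
    proof -
      have "(reps a m (J (Suc s)) - reps a m (J s)) \<inter> {0..<N}
        = (reps a m (J (Suc s)) \<inter> {0..<N}) - (reps a m (J s) \<inter> {0..<N})" by blast
      moreover have sub: "reps a m (J s) \<inter> {0..<N} \<subseteq> reps a m (J (Suc s)) \<inter> {0..<N}"
        using mono[of s] by blast
      moreover have "c s \<le> c (Suc s)" unfolding c_def by (rule card_mono[OF _ sub]) simp
      ultimately show ?thesis unfolding c_def by (simp add: card_Diff_subset of_nat_diff)
    qed
    \<comment> \<open>The numbers of new elements telescope to c T - c 0, which is at most N, so
      they cannot all exceed N / T.\<close>
    have "\<exists>s<T. card ((reps a m (J (Suc s)) - reps a m (J s)) \<inter> {0..<N}) * T \<le> nat N"
    proof (rule ccontr)
      assume no: "\<not> ?thesis"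
      have T0: "T > 0" using T by (cases "T = 0") auto
      have "N * int T = (\<Sum>s<T. N)" by simp
      also have "\<dots> < (\<Sum>s<T. (int (c (Suc s)) - int (c s)) * int T)"
      proof (rule sum_strict_mono)
        fix s assume "s \<in> {..<T}"
        then have "nat N < card ((reps a m (J (Suc s)) - reps a m (J s)) \<inter> {0..<N}) * T" using no by auto
        then have "int (nat N) < int (card ((reps a m (J (Suc s)) - reps a m (J s)) \<inter> {0..<N}) * T)"
          by (simp only: of_nat_less_iff)
        then show "N < (int (c (Suc s)) - int (c s)) * int T" using N(1) by (simp add: g)
      qed (use T0 in auto)
      also have "\<dots> = (\<Sum>s<T. int (c (Suc s)) - int (c s)) * int T" by (simp add: sum_distrib_right)
      also have "\<dots> = (int (c T) - int (c 0)) * int T" by (subst sum_lessThan_telescope) simp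
      finally have "N < int (c T) - int (c 0)" using T0 by simp
      moreover have "c T \<le> card {0..<N}" unfolding c_def by (rule card_mono) auto
      ultimately show False using N(1) by simp
    qed
    then obtain s where s: "s < T" "card ((reps a m (J (Suc s)) - reps a m (J s)) \<inter> {0..<N}) * T \<le> nat N" by blast
    have JSuc: "J (Suc s) = J s \<union> {idx s}" "J s \<inter> {idx s} = {}" unfolding J_def idx_def by auto
    have AV: "u + v \<in> reps a m (J (Suc s))" if "u \<in> reps a m (J s)" "v \<in> V s" for u v
    proof -
      have "v \<in> reps a m {idx s}" using that(2) unfolding V_def reps_def by auto
      then show ?thesis unfolding JSuc(1) using that(1) Jsub JSuc(2) by (intro reps_Un_add) auto
    qed
    have Vn: "V s \<subseteq> {0..}" unfolding V_def using am' by (auto intro!: mult_nonneg_nonneg polygonal_nonneg)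
    have basis: "\<exists>vs. set vs \<subseteq> V s \<and> length vs = 8 \<and> sum_list vs = d s * k" if "k \<ge> 0" for k
      unfolding V_def d_def by (rule polygonal_eight_basis[OF that])
    have H: "(n + 1) div 3 \<ge> 1" using N(1) unfolding N_def by linarith
    \<comment> \<open>The density of the three initial indices passes to every J s, so
      \<open>\<delta>0\<close> does not depend on s and could be fixed before T.\<close>
    have "J 0 \<subseteq> J s" unfolding J_def by auto
    then have "reps a m (J 0) \<inter> {0..<(n + 1) div 3} \<subseteq> reps a m (J s) \<inter> {0..<(n + 1) div 3}"
      using reps_mono[OF Jsub(2)[of s], of "J 0" a m] by blast
    then have "card (reps a m (J 0) \<inter> {0..<(n + 1) div 3}) \<le> card (reps a m (J s) \<inter> {0..<(n + 1) div 3})"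
      by (intro card_mono) auto
    then have D0: "\<delta>0 * real_of_int ((n + 1) div 3) \<le> card (reps a m (J s) \<inter> {0..<(n + 1) div 3})"
      using \<delta>0(2)[OF H] by linarith
    have "N \<ge> d s" using N(3) dm[OF s(1)] by linarith
    then have "\<exists>f\<in>reps a m {..<r}. \<exists>b\<in>reps a m J1. \<exists>v\<in>reps a m (J s). n = f + b + v"
      using represent_at_scale[OF nonneg AV Vn d basis _ _ _ _ \<delta>0(1) D0 \<delta>1(1) \<delta>1(2)[OF H] T nonneg L[OF s(1)]]
        N(1,2) s(2) unfolding N_def by blast
    then obtain f b v where f: "f \<in> reps a m {..<r}" and b: "b \<in> reps a m J1" and v: "v \<in> reps a m (J s)"
      and n: "n = f + b + v" by blast
    have "f + b \<in> reps a m ({..<r} \<union> J1)" using f b by (intro reps_Un_add) (auto simp: J1_def)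
    then have "n \<in> reps a m (({..<r} \<union> J1) \<union> J s)" unfolding n
      by (rule reps_Un_add[rotated 3, OF _ v]) (auto simp: J1_def J_def)
    moreover have "reps a m (({..<r} \<union> J1) \<union> J s) \<subseteq> reps a m {..<R}"
      by (rule reps_mono) (use s(1) in \<open>auto simp: J1_def J_def R_def\<close>)
    ultimately show ?thesis by blast
  qed
  obtain q where q: "\<forall>n<nat n0. int n \<in> reps a m {..<q}"
    using exists_prefix_representing_initial_segment[OF rep] by blast
  have "int n \<in> reps a m {..<max q R}" for n :: nat
  proof (cases "n < nat n0")
    case True
    have "reps a m {..<q} \<subseteq> reps a m {..<max q R}" by (rule reps_mono) auto
    then show ?thesis using q True by blast
  next
    case False
    then have "int n \<in> reps a m {..<R}" by (intro large) linarith
    moreover have "reps a m {..<R} \<subseteq> reps a m {..<max q R}" by (rule reps_mono) auto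
    ultimately show ?thesis by blast
  qed
  then show ?thesis by blast
qed

section \<open>Koenig's lemma for the tree, and the growth of represented initial segments\<close>

section \<open>The escalator tree\<close>

lemma represents_iff_reps:
  "represents F n \<longleftrightarrow> int n \<in> reps (\<lambda>i. fst (F ! i)) (\<lambda>i. snd (F ! i)) {..<length F}"
proof
  assume "represents F n"
  then obtain x where "length x = length F" "polysum_value F x = int n" unfolding represents_def by blast
  then show "int n \<in> reps (\<lambda>i. fst (F ! i)) (\<lambda>i. snd (F ! i)) {..<length F}"
    by (intro repsI[where x = "\<lambda>i. x ! i"]) (simp add: polysum_value_def)
next
  assume "int n \<in> reps (\<lambda>i. fst (F ! i)) (\<lambda>i. snd (F ! i)) {..<length F}"
  then obtain x where x: "int n = (\<Sum>i<length F. int (fst (F ! i)) * polygonal (snd (F ! i)) (x i))"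
    unfolding reps_def by auto
  have "polysum_value F (map x [0..<length F]) = int n" unfolding x polysum_value_def by (intro sum.cong) auto
  then show "represents F n" unfolding represents_def by (intro exI[of _ "map x [0..<length F]"]) simp
qed

lemma polygonal_1 [simp]: "polygonal m 1 = 1"
  by (simp add: polygonal_def)

lemma represents_snoc_0: "represents F n \<Longrightarrow> represents (F @ [(a, m)]) n"
proof -
  assume "represents F n"
  then obtain x where x: "length x = length F" "polysum_value F x = int n" unfolding represents_def by blast
  have "polysum_value (F @ [(a, m)]) (x @ [0]) = polysum_value F x"
    using x(1) unfolding polysum_value_def by (simp add: nth_append)
  then show ?thesis unfolding represents_def using x by (intro exI[of _ "x @ [0]"]) simp
qed

lemma represents_snoc_1: "represents F n \<Longrightarrow> represents (F @ [(a, m)]) (n + a)"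
proof -
  assume "represents F n"
  then obtain x where x: "length x = length F" "polysum_value F x = int n" unfolding represents_def by blast
  have "polysum_value (F @ [(a, m)]) (x @ [1]) = polysum_value F x + int a"
    using x(1) unfolding polysum_value_def by (simp add: nth_append)
  then show ?thesis unfolding represents_def using x by (intro exI[of _ "x @ [1]"]) simp
qed

lemma represents_0: "represents F 0"
  unfolding represents_iff_reps by (simp add: zero_in_reps)

lemma represents_below_truant:
  assumes "enat n < truant F" shows "represents F n"
proof (cases "universal F \<or> n = 0")
  case True
  then show ?thesis using represents_0 unfolding universal_def by (cases "n = 0") auto
next
  case False
  then have "n < (LEAST n. 1 \<le> n \<and> \<not> represents F n)" using assms by (simp add: truant_def)
  then have "\<not> (1 \<le> n \<and> \<not> represents F n)" by (rule not_less_Least)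
  then show ?thesis using False by simp
qed

text \<open>If n itself is not represented by F, the truant is at most n, so the new coefficient a
  is at most n. Then n - a is represented by F, and the new variable at 1 contributes a.\<close>

lemma escalator_child_represents_initial_segment:
  assumes ch: "escalator_child M F G" and rep: "\<And>k. k < n \<Longrightarrow> represents F k" and k: "k \<le> n"
  shows "represents G k"
proof -
  obtain a m where G: "G = F @ [(a, m)]" "G \<in> polysum_class M" "enat a \<le> truant F"
    using ch unfolding escalator_child_def by blast
  have a: "a \<ge> 1" using G(1,2) unfolding polysum_class_def is_polysum_def by auto
  show ?thesis
  proof (cases "represents F k")
    case True
    then show ?thesis unfolding G(1) by (rule represents_snoc_0)
  next
    case False
    then have "k = n" "\<not> enat k < truant F" using rep k represents_below_truant le_neq_implies_less by blast+
    then have "enat a \<le> enat k" using G(3) by (meson linorder_not_less order_trans)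
    then have "a \<le> k" by simp
    then have "represents F (k - a)" using rep \<open>k = n\<close> a by (simp)
    then show ?thesis unfolding G(1) using represents_snoc_1[of F "k - a" a m] \<open>a \<le> k\<close> by simp
  qed
qed

lemma polysum_class_bounds:
  assumes "F \<in> polysum_class M" "(a, m) \<in> set F"
  shows "1 \<le> a \<and> 3 \<le> m \<and> m \<le> M + 2"
proof -
  have b: "1 \<le> a" "3 \<le> m" and M: "Lcm ((\<lambda>(a, m). m - 2) ` set F) \<le> M"
    and all: "\<forall>(a, m) \<in> set F. 3 \<le> m"
    using assms unfolding polysum_class_def is_polysum_def by auto
  have "m - 2 dvd Lcm ((\<lambda>(a, m). m - 2) ` set F)" using assms(2) by (intro dvd_Lcm) force
  \<comment> \<open>Over the natural numbers an lcm with a factor 0 is 0, and the bound by M would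
    then say nothing about m.\<close>
  moreover have "Lcm ((\<lambda>(a, m). m - 2) ` set F) \<noteq> 0"
    using all by (auto simp: Lcm_0_iff)
  ultimately have "m - 2 \<le> Lcm ((\<lambda>(a, m). m - 2) ` set F)" by (metis dvd_imp_le neq0_conv)
  then show ?thesis using M b by linarith
qed

text \<open>The truant bounds the new coefficient, and the lcm condition bounds the new m.\<close>

lemma finite_escalator_children: "finite {G. escalator_child M F G}"
proof (cases "truant F")
  case (enat t)
  have "{G. escalator_child M F G} \<subseteq> (\<lambda>(a, m). F @ [(a, m)]) ` ({..t} \<times> {..M + 2})"
  proof
    fix G assume "G \<in> {G. escalator_child M F G}"
    then obtain a m where G: "G = F @ [(a, m)]" "G \<in> polysum_class M" "enat a \<le> truant F"
      unfolding escalator_child_def by blast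
    then have "m \<le> M + 2" using polysum_class_bounds[OF G(2), of a m] by simp
    then show "G \<in> (\<lambda>(a, m). F @ [(a, m)]) ` ({..t} \<times> {..M + 2})" using G enat by auto
  qed
  then show ?thesis by (rule finite_subset) simp
next
  case infinity
  then show ?thesis by (simp add: escalator_child_def)
qed

definition escalator_descendants :: "nat \<Rightarrow> polysum \<Rightarrow> polysum set" where
  "escalator_descendants M F = {G. (escalator_child M)\<^sup>*\<^sup>* F G}"

lemma escalator_tree_eq_descendants: "escalator_tree M = escalator_descendants M []"
proof (intro equalityI subsetI)
  fix G assume "G \<in> escalator_tree M"
  then show "G \<in> escalator_descendants M []"
    unfolding escalator_descendants_def by induction auto
next
  fix G assume "G \<in> escalator_descendants M []"
  then have "(escalator_child M)\<^sup>*\<^sup>* [] G" unfolding escalator_descendants_def by simp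
  then show "G \<in> escalator_tree M"
    by induction (auto intro: escalator_tree.intros)
qed

text \<open>The step of Koenig's lemma: with finitely many children, finite subtrees below all of
  them would make the whole subtree finite.\<close>

lemma infinite_descendants_child:
  assumes "infinite (escalator_descendants M F)"
  shows "\<exists>G. escalator_child M F G \<and> infinite (escalator_descendants M G)"
proof (rule ccontr)
  assume no: "\<not> ?thesis"
  have "escalator_descendants M F \<subseteq> insert F (\<Union>G\<in>{G. escalator_child M F G}. escalator_descendants M G)"
  proof
    fix H assume "H \<in> escalator_descendants M F"
    then have "(escalator_child M)\<^sup>*\<^sup>* F H" unfolding escalator_descendants_def by simp
    then show "H \<in> insert F (\<Union>G\<in>{G. escalator_child M F G}. escalator_descendants M G)"
      by (cases rule: converse_rtranclpE) (auto simp: escalator_descendants_def)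
  qed
  moreover have "finite (insert F (\<Union>G\<in>{G. escalator_child M F G}. escalator_descendants M G))"
    using no by (auto simp: finite_escalator_children)
  ultimately show False using assms finite_subset by blast
qed

theorem theorem6p1:
  fixes M :: nat
  assumes "M \<ge> 1"
  shows "finite (escalator_tree M)"
proof (rule ccontr)
  assume "infinite (escalator_tree M)"
  then have inf: "infinite (escalator_descendants M [])" unfolding escalator_tree_eq_descendants .
  \<comment> \<open>Dependent choice; the clause for r = 0 pins the branch to the root.\<close>
  obtain F where F0: "F 0 = []" and child: "\<And>r. escalator_child M (F r) (F (Suc r))"
    using dependent_nat_choice[where P = "\<lambda>r G. infinite (escalator_descendants M G) \<and> (r = 0 \<longrightarrow> G = [])"
        and Q = "\<lambda>r G H. escalator_child M G H"] infinite_descendants_child inf by (metis nat.distinct(1))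
  have step: "\<exists>p. F (Suc r) = F r @ [p]" for r using child[of r] unfolding escalator_child_def by blast
  have len: "length (F r) = r" for r
    by (induction r) (use F0 step in \<open>auto, metis length_append_singleton\<close>)
  \<comment> \<open>Every node extends its parent by one term, so the branch is a single infinite
    sequence of terms, and F r is its prefix of length r.\<close>
  define p where "p i = F (Suc i) ! i" for i
  have nth: "F r ! i = p i" if "i < r" for r i
    using that
  proof (induction r)
    case (Suc r)
    then show ?case using step[of r] len[of r] by (cases "i = r") (auto simp: p_def nth_append)
  qed simp
  have rep: "represents (F r) n \<longleftrightarrow> int n \<in> reps (\<lambda>i. fst (p i)) (\<lambda>i. snd (p i)) {..<r}" for r n
  proof -
    have "reps (\<lambda>i. fst (F r ! i)) (\<lambda>i. snd (F r ! i)) {..<r} = reps (\<lambda>i. fst (p i)) (\<lambda>i. snd (p i)) {..<r}"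
      unfolding reps_def by (intro arg_cong[where f = range] ext sum.cong refl) (simp add: nth)
    then show ?thesis unfolding represents_iff_reps len by simp
  qed
  have bounds: "1 \<le> fst (p i) \<and> 3 \<le> snd (p i) \<and> snd (p i) \<le> M + 2" for i
  proof (rule polysum_class_bounds)
    show "F (Suc i) \<in> polysum_class M" using child[of i] unfolding escalator_child_def by blast
    have "p i \<in> set (F (Suc i))" unfolding p_def using len[of "Suc i"] by (intro nth_mem) simp
    then show "(fst (p i), snd (p i)) \<in> set (F (Suc i))" by simp
  qed
  \<comment> \<open>Each edge lengthens the represented initial segment by at least one number,
    starting from the empty segment at the root; thus n is represented at depth n + 1.\<close>
  have seg: "represents (F n) k" if "k < n" for n k
    using that
  proof (induction n arbitrary: k)
    case (Suc n)
    show ?case by (rule escalator_child_represents_initial_segment[OF child Suc.IH]) (use Suc.prems in auto)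
  qed simp
  have "\<exists>r. int n \<in> reps (\<lambda>i. fst (p i)) (\<lambda>i. snd (p i)) {..<r}" for n
    using seg[of n "Suc n"] unfolding rep by blast
  then obtain r where "\<And>n::nat. int n \<in> reps (\<lambda>i. fst (p i)) (\<lambda>i. snd (p i)) {..<r}"
    using exists_universal_prefix[of "\<lambda>i. fst (p i)" "\<lambda>i. snd (p i)" "M + 2"] bounds by blast
  then have "universal (F r)" unfolding universal_def rep by blast
  then have "truant (F r) = \<infinity>" by (simp add: truant_def)
  then show False using child[of r] unfolding escalator_child_def by simp
qed

end
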